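(* Let $(K,v)$ be a field with valuation with value group $\Gamma$, let $w\in\Gamma^n$, let $\prec$ be a monomial order on $K[x_1,\ldots,x_n]$, and let $d\ge1$. Let $B$ be a finite set of nonzero homogeneous elements of $K[x_1,\ldots,x_n]^d$ generating the submodule $I$. Consider the following procedure. Initialize $G=B$ and $C=G\times G$. While $C\neq\emptyset$: choose a pair $(f,g)\in C$ and remove it from $C$; let $r$ be a remainder of $\operatorname{S-form}(f,g)$ on division by $G$; if $r\ne0$, replace $C$ by $C\cup(G\times\{r\})$ and then replace $G$ by $G\cup\{r\}$. When $C=\emptyset$, return $G$. Then this procedure terminates after finitely many steps, and the returned set $G$ is a Gröbner basis of $I$ (with respect to $w$).
   Context: A field with valuation is a field $K$ with a function $v:K\to\mathbb{R}\cup\{\infty\}$ such that $v$ restricts to a group homomorphism $K^*\to(\mathbb{R},+)$, $v(a+b)\ge\min\{v(a),v(b)\}$, and $v(a)=\infty$ iff $a=0$. Its value group is $\Gamma=v(K^* )$; $R_K=\{c\in K:v(c)\ge0\}$ is a local ring with maximal ideal $J_K=\{c:v(c)>0\}$ and residue field $\Bbbk=R_K/J_K$; $\overline{a}$ denotes the image of $a\in R_K$ in $\Bbbk$. A group homomorphism $\Gamma\to K^*$, $\gamma\mapsto t^\gamma$, with $v(t^\gamma)=\gamma$ is fixed. Let $e_1,\ldots,e_d$ be the standard basis. Every element of $K[x_1,\ldots,x_n]^d$ is a finite sum $f=\sum c_{u,k}x^ue_k$; $c_{u,k}x^ue_k$ is called a term, $x^ue_k$ a monomial, of degree $|u|=u_1+\cdots+u_n$,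 and $\operatorname{supp}(f)=\{(u,k):c_{u,k}\ne0\}$. An element is homogeneous if all its monomials have the same degree. Monomials are ordered by: $x^\alpha e_i\prec x^\beta e_j$ if $x^\alpha\prec x^\beta$, or $x^\alpha=x^\beta$ and $e_i\prec e_j$, where $e_1\prec\cdots\prec e_d$. For $f\ne0$ put $W=\min_{(u,k)\in\operatorname{supp}(f)}\{v(c_{u,k})+w\cdot u\}$. The initial form is $$\operatorname{in}_w(f)=\sum_{(u,k)\in\operatorname{supp}(f),\ v(c_{u,k})+w\cdot u=W}\overline{c_{u,k}t^{-v(c_{u,k})}}\,x^ue_k\in\Bbbk[x_1,\ldots,x_n]^d,$$ with $\operatorname{in}_w(0)=0$. The term $\operatorname{in}_{w,\prec}(f)$ is the term $c_{u,k}x^ue_k$ of $f$ whose monomial is the $\prec$-largest monomial of $\operatorname{in}_w(f)$. For a submodule $I$, $\operatorname{in}_w(I)=\langle\operatorname{in}_w(f):f\in I\rangle\subseteq\Bbbk[x_1,\ldots,x_n]^d$. A finite generating set $G=\{g_1,\ldots,g_s\}$ of $I$ is a Gröbner basis of $I$ (with respect to $w$) iff $\operatorname{in}_w(I)=\langle\operatorname{in}_w(g_1),\ldots,\operatorname{in}_w(g_s)\rangle$. Nonzero terms are compared by: $ax^\alpha e_i<bx^\beta e_j$ if $v(a)+w\cdot\alpha<v(b)+w\cdot\beta$, or if these are equal and $x^\alpha e_i\succ x^\beta e_j$; $t\ge t'$ means that $t<t'$ does not hold. By convention $\operatorname{in}_{w,\prec}(0)=0$ is larger than every nonzero term and $0\ge0$.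 A nonzero term $bx^\beta e_j$ divides $ax^\alpha e_i$ if $i=j$ and $bx^\beta$ divides $ax^\alpha$. For terms, $\operatorname{LCM}(ax^\alpha e_i,bx^\beta e_j)=\operatorname{LCM}(x^\alpha,x^\beta)e_j$ if $i=j$, and $0$ otherwise. For nonzero $f,g$ with $m=\operatorname{LCM}(\operatorname{in}_{w,\prec}(f),\operatorname{in}_{w,\prec}(g))$, $$\operatorname{S-form}(f,g)=\frac{m}{\operatorname{in}_{w,\prec}(f)}f-\frac{m}{\operatorname{in}_{w,\prec}(g)}g,$$ where, for $m\neq0$, the quotient is the term of $K[x_1,\ldots,x_n]$ whose product with the denominator is $m$; if $m=0$ the S-form is $0$. A remainder of a homogeneous $f$ on division by a finite set $G=\{g_1,\ldots,g_s\}$ of nonzero homogeneous elements is an element $r\in K[x_1,\ldots,x_n]^d$, either zero or homogeneous of the same degree as $f$ (and $r=0$ if $f=0$), for which there are $h_1,\ldots,h_s\in K[x_1,\ldots,x_n]$ with $f=\sum_ih_ig_i+r$, $\operatorname{in}_{w,\prec}(r)\ge\operatorname{in}_{w,\prec}(f)$, $\operatorname{in}_{w,\prec}(h_ig_i)\ge\operatorname{in}_{w,\prec}(f)$ for all $i$, and no monomial of $r$ divisible by any $\operatorname{in}_{w,\prec}(g_i)$. Such remainders always exist and are produced by a division algorithm. *)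

theory Defs
  imports "HOL-Analysis.Analysis" "HOL-Library.Poly_Mapping"
begin

subsection \<open>Fields with valuation\<close>

class valued_field = field +
  fixes val :: "'a \<Rightarrow> ereal"
  assumes val_eq_PInfty_iff: "val a = \<infinity> \<longleftrightarrow> a = 0"
    and val_neq_MInfty: "val a \<noteq> - \<infinity>"
    and val_mult: "a \<noteq> 0 \<Longrightarrow> b \<noteq> 0 \<Longrightarrow> val (a * b) = val a + val b"
    and val_add: "min (val a) (val b) \<le> val (a + b)"

definition value_group :: "'a::valued_field itself \<Rightarrow> real set" where
  "value_group _ = {\<gamma>. \<exists>a::'a. a \<noteq> 0 \<and> val a = ereal \<gamma>}"

text \<open>The map \<open>\<gamma> \<mapsto> t\<^sup>\<gamma>\<close>; its values outside the value group are irrelevant.\<close>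

definition val_section :: "(real \<Rightarrow> 'a::valued_field) \<Rightarrow> bool" where
  "val_section t \<longleftrightarrow>
     (\<forall>\<gamma>\<in>value_group TYPE('a). t \<gamma> \<noteq> 0 \<and> val (t \<gamma>) = ereal \<gamma>) \<and>
     (\<forall>\<gamma>\<in>value_group TYPE('a). \<forall>\<delta>\<in>value_group TYPE('a). t (\<gamma> + \<delta>) = t \<gamma> * t \<delta>)"

lemma val_0 [simp]: "val (0::'a::valued_field) = \<infinity>"
  by (simp add: val_eq_PInfty_iff)

lemma val_times: "val (a * b) = val a + val (b::'a::valued_field)"
  by (cases "a = 0 \<or> b = 0") (auto simp: val_mult val_neq_MInfty)

lemma val_1 [simp]: "val (1::'a::valued_field) = 0"
proof -
  have "val (1::'a) = val (1::'a) + val (1::'a)"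
    using val_times[of "1::'a" 1] by simp
  then show ?thesis
    using val_neq_MInfty[of "1::'a"] val_eq_PInfty_iff[of "1::'a"]
    by (cases "val (1::'a)") auto
qed

lemma val_uminus [simp]: "val (- a) = val (a::'a::valued_field)"
proof -
  have "val (- 1 :: 'a) + val (- 1 :: 'a) = 0"
    using val_times[of "- 1 :: 'a" "- 1"] by simp
  then have "val (- 1 :: 'a) = 0"
    by (cases "val (- 1 :: 'a)") auto
  then show ?thesis
    using val_times[of "- 1" a] by simp
qed

lemma val_diff_commute: "val (a - b) = val (b - a :: 'a::valued_field)"
  using val_uminus[of "a - b"] by simp

lemma val_inverse: "a \<noteq> 0 \<Longrightarrow> val (inverse a) = - val (a::'a::valued_field)"
  using val_times[of a "inverse a"] val_eq_PInfty_iff[of a] val_neq_MInfty[of a]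
  by (cases "val a"; cases "val (inverse a)") auto

lemma val_add_ge: "c \<le> val a \<Longrightarrow> c \<le> val b \<Longrightarrow> c \<le> val (a + b :: 'a::valued_field)"
  using val_add[of a b] by (auto simp: min_def split: if_splits)

lemma val_add_gt: "c < val a \<Longrightarrow> c < val b \<Longrightarrow> c < val (a + b :: 'a::valued_field)"
  using val_add[of a b] by (auto simp: min_def split: if_splits)

lemma val_mult_pos: "0 < val a \<Longrightarrow> 0 \<le> val b \<Longrightarrow> 0 < val (a * b :: 'a::valued_field)"
  by (simp add: val_times add_pos_nonneg)

subsection \<open>The residue field\<close>

text \<open>The quotient of the valuation ring \<open>{c. 0 \<le> val c}\<close> by its maximal ideal
  \<open>{c. 0 < val c}\<close>. The quotient map is \<open>abs_residue\<close>, which is meaningful only on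
  the valuation ring.\<close>

quotient_type (overloaded) 'a residue = "'a::valued_field" / partial:
  "\<lambda>a b. 0 \<le> val a \<and> 0 \<le> val b \<and> 0 < val (a - b)"
proof (rule part_equivpI)
  show "\<exists>x::'a. 0 \<le> val x \<and> 0 \<le> val x \<and> 0 < val (x - x)"
    by (rule exI[of _ 0]) simp
  show "symp (\<lambda>a b::'a. 0 \<le> val a \<and> 0 \<le> val b \<and> 0 < val (a - b))"
    by (auto intro!: sympI simp: val_diff_commute)
  show "transp (\<lambda>a b::'a. 0 \<le> val a \<and> 0 \<le> val b \<and> 0 < val (a - b))"
  proof (rule transpI, elim conjE, intro conjI)
    fix a b c :: 'a
    assume "0 < val (a - b)" "0 < val (b - c)"
    then have "0 < val ((a - b) + (b - c))" by (rule val_add_gt)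
    then show "0 < val (a - c)" by simp
  qed
qed

lemma val_eq_0_cong:
  fixes a b :: "'a::valued_field"
  assumes "val a = 0" "0 \<le> val b" "0 < val (a - b)"
  shows "val b = 0"
proof (rule ccontr)
  assume "val b \<noteq> 0"
  with assms have "0 < val b" by auto
  with assms have "0 < val ((a - b) + b)" by (intro val_add_gt)
  with assms show False by simp
qed

instantiation residue :: (valued_field) field
begin

lift_definition zero_residue :: "'a residue" is 0 by simp

lift_definition one_residue :: "'a residue" is 1 by simp

lift_definition plus_residue :: "'a residue \<Rightarrow> 'a residue \<Rightarrow> 'a residue" is "(+)"
  by (metis add_diff_add val_add_ge val_add_gt)

lift_definition uminus_residue :: "'a residue \<Rightarrow> 'a residue" is uminus
  by (metis minus_diff_minus val_uminus)

lift_definition minus_residue :: "'a residue \<Rightarrow> 'a residue \<Rightarrow> 'a residue" is "(-)"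
proof (elim conjE, intro conjI)
  fix a b c d :: 'a
  assume *: "0 \<le> val a" "0 \<le> val b" "0 < val (a - b)"
    "0 \<le> val c" "0 \<le> val d" "0 < val (c - d)"
  show "0 \<le> val (a - c)" using val_add_ge[of 0 a "- c"] * by simp
  show "0 \<le> val (b - d)" using val_add_ge[of 0 b "- d"] * by simp
  have "0 < val ((a - b) + - (c - d))" using * by (intro val_add_gt) (simp_all only: val_uminus)
  then show "0 < val (a - c - (b - d))" by (simp add: algebra_simps)
qed

lift_definition times_residue :: "'a residue \<Rightarrow> 'a residue \<Rightarrow> 'a residue" is "(*)"
proof (elim conjE, intro conjI)
  fix a b c d :: 'a
  assume *: "0 \<le> val a" "0 \<le> val b" "0 < val (a - b)"
    "0 \<le> val c" "0 \<le> val d" "0 < val (c - d)"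
  show "0 \<le> val (a * c)" "0 \<le> val (b * d)" using * by (simp_all add: val_times)
  have "0 < val ((a - b) * c + (c - d) * b)"
    using * by (intro val_add_gt val_mult_pos)
  then show "0 < val (a * c - b * d)" by (simp add: algebra_simps)
qed

lift_definition inverse_residue :: "'a residue \<Rightarrow> 'a residue" is
  "\<lambda>a. if val a = 0 then inverse a else 0"
proof (elim conjE)
  fix a b :: 'a
  assume *: "0 \<le> val a" "0 \<le> val b" "0 < val (a - b)"
  have iff: "val a = 0 \<longleftrightarrow> val b = 0"
    using val_eq_0_cong[of a b] val_eq_0_cong[of b a] * by (auto simp: val_diff_commute)
  show "0 \<le> val (if val a = 0 then inverse a else 0) \<and>
      0 \<le> val (if val b = 0 then inverse b else 0) \<and>
      0 < val ((if val a = 0 then inverse a else 0) - (if val b = 0 then inverse b else 0))"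
  proof (cases "val a = 0")
    case True
    with iff have 0: "val a = 0" "val b = 0" by auto
    then have nz: "a \<noteq> 0" "b \<noteq> 0" by auto
    have "inverse a - inverse b = (b - a) * inverse (a * b)"
      using nz by (simp add: field_simps)
    then have "val (inverse a - inverse b) = val (a - b)"
      using nz 0 by (simp only: val_times val_inverse) (simp add: val_inverse val_times val_diff_commute[of b a])
    then show ?thesis using 0 nz * by (simp add: val_inverse)
  next
    case False
    then show ?thesis using iff by simp
  qed
qed

definition divide_residue :: "'a residue \<Rightarrow> 'a residue \<Rightarrow> 'a residue" where
  "divide_residue a b = a * inverse b"

instance
proof
  fix a b c :: "'a residue"
  show "a * b * c = a * (b * c)"
    by transfer (simp add: val_times mult.assoc)
  show "a * b = b * a"
    by transfer (simp add: val_times mult.commute)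
  show "1 * a = a"
    by transfer simp
  show "a + b + c = a + (b + c)"
    by transfer (simp add: val_add_ge add.assoc)
  show "a + b = b + a"
    by transfer (simp add: val_add_ge add.commute)
  show "0 + a = a"
    by transfer simp
  show "- a + a = 0"
    by transfer simp
  show "a - b = a + - b"
  proof transfer
    fix a b :: 'a
    assume *: "0 \<le> val a \<and> 0 \<le> val a \<and> 0 < val (a - a)"
      "0 \<le> val b \<and> 0 \<le> val b \<and> 0 < val (b - b)"
    then have "0 \<le> val (a + - b)" by (intro val_add_ge) auto
    then show "0 \<le> val (a - b) \<and> 0 \<le> val (a + - b) \<and> 0 < val (a - b - (a + - b))"
      by simp
  qed
  show "(a + b) * c = a * c + b * c"
  proof transfer
    fix a b c :: 'a
    assume *: "0 \<le> val a \<and> 0 \<le> val a \<and> 0 < val (a - a)"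
      "0 \<le> val b \<and> 0 \<le> val b \<and> 0 < val (b - b)"
      "0 \<le> val c \<and> 0 \<le> val c \<and> 0 < val (c - c)"
    then have "0 \<le> val ((a + b) * c)" by (simp add: val_times val_add_ge)
    then show "0 \<le> val ((a + b) * c) \<and> 0 \<le> val (a * c + b * c) \<and>
        0 < val ((a + b) * c - (a * c + b * c))"
      by (simp add: distrib_right)
  qed
  show "(0::'a residue) \<noteq> 1"
    by transfer simp
  show "a div b = a * inverse b"
    by (rule divide_residue_def)
  show "inverse (0::'a residue) = 0"
    by transfer simp
  show "inverse a * a = 1" if "a \<noteq> 0"
    using that
  proof transfer
    fix a :: 'a
    assume *: "0 \<le> val a \<and> 0 \<le> val a \<and> 0 < val (a - a)"
      "\<not> (0 \<le> val a \<and> 0 \<le> val (0::'a) \<and> 0 < val (a - 0))"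
    then have 0: "val a = 0" by auto
    then have "a \<noteq> 0" by auto
    with 0 show "0 \<le> val ((if val a = 0 then inverse a else 0) * a) \<and>
        0 \<le> val (1::'a) \<and> 0 < val ((if val a = 0 then inverse a else 0) * a - 1)"
      by simp
  qed
qed

end

subsection \<open>Polynomials and the free module\<close>

text \<open>The variables are indexed by a finite type and the basis vectors
  by a finite linearly ordered type, so that \<open>e\<^sub>1 \<prec> \<dots> \<prec> e\<^sub>d\<close> is the order of that type.
  A monomial \<open>x\<^sup>u e\<^sub>k\<close> is encoded as the pair \<open>(u, k)\<close>.\<close>

type_synonym 'n expo = "'n \<Rightarrow>\<^sub>0 nat"

type_synonym ('a, 'n) mpoly = "('n \<Rightarrow>\<^sub>0 nat) \<Rightarrow>\<^sub>0 'a"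

type_synonym ('a, 'n, 'd) pvec = "(('a, 'n) mpoly, 'd) vec"

interpretation pvec: module "(*s) :: 'r::comm_ring_1 \<Rightarrow> 'r ^ 'd \<Rightarrow> 'r ^ 'd"
  by unfold_locales (simp_all add: vec_eq_iff algebra_simps)

abbreviation submodule_span :: "('r::comm_ring_1 ^ 'd) set \<Rightarrow> ('r ^ 'd) set" where
  "submodule_span \<equiv> module.span (*s)"

definition coef :: "('a::zero, 'n, 'd::finite) pvec \<Rightarrow> 'n expo \<times> 'd \<Rightarrow> 'a" where
  "coef f m = Poly_Mapping.lookup (f $ snd m) (fst m)"

definition supp :: "('a::zero, 'n, 'd::finite) pvec \<Rightarrow> ('n expo \<times> 'd) set" where
  "supp f = {m. coef f m \<noteq> 0}"

definition mterm :: "'a::zero \<Rightarrow> 'n expo \<times> 'd \<Rightarrow> ('a, 'n, 'd::finite) pvec" where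
  "mterm c m = axis (snd m) (Poly_Mapping.single (fst m) c)"

definition deg :: "'n::finite expo \<Rightarrow> nat" where
  "deg u = (\<Sum>i\<in>UNIV. Poly_Mapping.lookup u i)"

definition homogeneous_of :: "nat \<Rightarrow> ('a::zero, 'n::finite, 'd::finite) pvec \<Rightarrow> bool" where
  "homogeneous_of e f \<longleftrightarrow> (\<forall>m\<in>supp f. deg (fst m) = e)"

definition homogeneous :: "('a::zero, 'n::finite, 'd::finite) pvec \<Rightarrow> bool" where
  "homogeneous f \<longleftrightarrow> (\<exists>e. homogeneous_of e f)"

subsection \<open>Monomial orders\<close>

definition monomial_order :: "('n expo \<Rightarrow> 'n expo \<Rightarrow> bool) \<Rightarrow> bool" where
  "monomial_order prec \<longleftrightarrow>
     irreflp prec \<and> transp prec \<and> totalp prec \<and>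
     (\<forall>u v s. prec u v \<longrightarrow> prec (u + s) (v + s)) \<and>
     (\<forall>u. u \<noteq> 0 \<longrightarrow> prec 0 u)"

definition mono_less ::
    "('n expo \<Rightarrow> 'n expo \<Rightarrow> bool) \<Rightarrow> 'n expo \<times> 'd::linorder \<Rightarrow> 'n expo \<times> 'd \<Rightarrow> bool" where
  "mono_less prec m m' \<longleftrightarrow> prec (fst m) (fst m') \<or> (fst m = fst m' \<and> snd m < snd m')"

subsection \<open>Initial forms and initial terms\<close>

definition weight :: "real ^ 'n \<Rightarrow> 'n::finite expo \<Rightarrow> real" where
  "weight w u = (\<Sum>i\<in>UNIV. w $ i * real (Poly_Mapping.lookup u i))"

definition min_weight ::
    "real ^ 'n \<Rightarrow> ('a::valued_field, 'n::finite, 'd::finite) pvec \<Rightarrow> ereal" where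
  "min_weight w f = Min ((\<lambda>m. val (coef f m) + ereal (weight w (fst m))) ` supp f)"

definition in_form ::
    "(real \<Rightarrow> 'a) \<Rightarrow> real ^ 'n \<Rightarrow> ('a::valued_field, 'n::finite, 'd::finite) pvec
      \<Rightarrow> ('a residue, 'n, 'd) pvec" where
  "in_form t w f =
     (\<Sum>m | m \<in> supp f \<and> val (coef f m) + ereal (weight w (fst m)) = min_weight w f.
        mterm (abs_residue (coef f m * t (- real_of_ereal (val (coef f m))))) m)"

definition in_mono ::
    "(real \<Rightarrow> 'a) \<Rightarrow> real ^ 'n \<Rightarrow> ('n expo \<Rightarrow> 'n expo \<Rightarrow> bool)
      \<Rightarrow> ('a::valued_field, 'n::finite, 'd::{finite,linorder}) pvec \<Rightarrow> 'n expo \<times> 'd" where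
  "in_mono t w prec f =
     (THE m. m \<in> supp (in_form t w f) \<and>
        (\<forall>m'\<in>supp (in_form t w f). m' \<noteq> m \<longrightarrow> mono_less prec m' m))"

definition in_term ::
    "(real \<Rightarrow> 'a) \<Rightarrow> real ^ 'n \<Rightarrow> ('n expo \<Rightarrow> 'n expo \<Rightarrow> bool)
      \<Rightarrow> ('a::valued_field, 'n::finite, 'd::{finite,linorder}) pvec \<Rightarrow> ('a, 'n, 'd) pvec" where
  "in_term t w prec f =
     (if f = 0 then 0 else mterm (coef f (in_mono t w prec f)) (in_mono t w prec f))"

definition in_module ::
    "(real \<Rightarrow> 'a) \<Rightarrow> real ^ 'n \<Rightarrow> ('a::valued_field, 'n::finite, 'd::finite) pvec set
      \<Rightarrow> ('a residue, 'n, 'd) pvec set" where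
  "in_module t w I = submodule_span (in_form t w ` I)"

definition groebner_basis ::
    "(real \<Rightarrow> 'a) \<Rightarrow> real ^ 'n \<Rightarrow> ('a::valued_field, 'n::finite, 'd::finite) pvec set
      \<Rightarrow> ('a, 'n, 'd) pvec set \<Rightarrow> bool" where
  "groebner_basis t w I G \<longleftrightarrow>
     finite G \<and> submodule_span G = I \<and> in_module t w I = submodule_span (in_form t w ` G)"

subsection \<open>Comparison and divisibility of terms\<close>

text \<open>Both relations are meant for elements of the form \<open>mterm c m\<close>, including \<open>0\<close>.\<close>

definition term_less ::
    "real ^ 'n \<Rightarrow> ('n expo \<Rightarrow> 'n expo \<Rightarrow> bool)
      \<Rightarrow> ('a::valued_field, 'n::finite, 'd::{finite,linorder}) pvec \<Rightarrow> ('a, 'n, 'd) pvec \<Rightarrow> bool" where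
  "term_less w prec p q \<longleftrightarrow>
     (p \<noteq> 0 \<and> q = 0) \<or>
     (\<exists>a m b m'. a \<noteq> 0 \<and> b \<noteq> 0 \<and> p = mterm a m \<and> q = mterm b m' \<and>
        (val a + ereal (weight w (fst m)) < val b + ereal (weight w (fst m')) \<or>
         (val a + ereal (weight w (fst m)) = val b + ereal (weight w (fst m')) \<and>
          mono_less prec m' m)))"

abbreviation term_ge ::
    "real ^ 'n \<Rightarrow> ('n expo \<Rightarrow> 'n expo \<Rightarrow> bool)
      \<Rightarrow> ('a::valued_field, 'n::finite, 'd::{finite,linorder}) pvec \<Rightarrow> ('a, 'n, 'd) pvec \<Rightarrow> bool" where
  "term_ge w prec p q \<equiv> \<not> term_less w prec p q"

definition term_dvd ::
    "('a::field, 'n, 'd::finite) pvec \<Rightarrow> ('a, 'n, 'd) pvec \<Rightarrow> bool" where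
  "term_dvd q p \<longleftrightarrow>
     (\<exists>b \<beta> a \<alpha> i. b \<noteq> 0 \<and> q = mterm b (\<beta>, i) \<and> p = mterm a (\<alpha>, i) \<and>
        Poly_Mapping.single \<beta> b dvd Poly_Mapping.single \<alpha> a)"

subsection \<open>S-forms and remainders\<close>

definition lcm_expo :: "'n::finite expo \<Rightarrow> 'n expo \<Rightarrow> 'n expo" where
  "lcm_expo u v =
     (\<Sum>i\<in>UNIV. Poly_Mapping.single i (max (Poly_Mapping.lookup u i) (Poly_Mapping.lookup v i)))"

definition lcm_mono :: "'n expo \<times> 'd \<Rightarrow> 'n expo \<times> 'd \<Rightarrow> ('a::field, 'n::finite, 'd::finite) pvec" where
  "lcm_mono m m' =
     (if snd m = snd m' then mterm 1 (lcm_expo (fst m) (fst m'), snd m) else 0)"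

definition term_quot :: "('a::field, 'n, 'd::finite) pvec \<Rightarrow> ('a, 'n, 'd) pvec \<Rightarrow> ('a, 'n) mpoly" where
  "term_quot m p = (THE q. (\<exists>c u. q = Poly_Mapping.single u c) \<and> q *s p = m)"

definition S_form ::
    "(real \<Rightarrow> 'a) \<Rightarrow> real ^ 'n \<Rightarrow> ('n expo \<Rightarrow> 'n expo \<Rightarrow> bool)
      \<Rightarrow> ('a::valued_field, 'n::finite, 'd::{finite,linorder}) pvec \<Rightarrow> ('a, 'n, 'd) pvec
      \<Rightarrow> ('a, 'n, 'd) pvec" where
  "S_form t w prec f g =
     (let m = lcm_mono (in_mono t w prec f) (in_mono t w prec g)
      in if m = 0 then 0
         else term_quot m (in_term t w prec f) *s f - term_quot m (in_term t w prec g) *s g)"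

text \<open>\<open>r\<close> is a remainder of \<open>f\<close> on division by \<open>G\<close>.\<close>

definition is_remainder ::
    "(real \<Rightarrow> 'a) \<Rightarrow> real ^ 'n \<Rightarrow> ('n expo \<Rightarrow> 'n expo \<Rightarrow> bool)
      \<Rightarrow> ('a::valued_field, 'n::finite, 'd::{finite,linorder}) pvec set
      \<Rightarrow> ('a, 'n, 'd) pvec \<Rightarrow> ('a, 'n, 'd) pvec \<Rightarrow> bool" where
  "is_remainder t w prec G f r \<longleftrightarrow>
     (\<exists>e. homogeneous_of e f \<and> homogeneous_of e r) \<and> (f = 0 \<longrightarrow> r = 0) \<and>
     (\<exists>h. f = (\<Sum>g\<in>G. h g *s g) + r \<and>
        term_ge w prec (in_term t w prec r) (in_term t w prec f) \<and>
        (\<forall>g\<in>G. term_ge w prec (in_term t w prec (h g *s g)) (in_term t w prec f)) \<and>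
        (\<forall>m\<in>supp r. \<forall>g\<in>G. \<not> term_dvd (in_term t w prec g) (mterm 1 m)))"

subsection \<open>The procedure\<close>

text \<open>One pass through the loop on states \<open>(G, C)\<close>. Both the pair and the remainder are chosen
  nondeterministically.\<close>

inductive buchberger_step ::
    "(real \<Rightarrow> 'a) \<Rightarrow> real ^ 'n \<Rightarrow> ('n expo \<Rightarrow> 'n expo \<Rightarrow> bool)
      \<Rightarrow> ('a::valued_field, 'n::finite, 'd::{finite,linorder}) pvec set
           \<times> (('a, 'n, 'd) pvec \<times> ('a, 'n, 'd) pvec) set
      \<Rightarrow> ('a, 'n, 'd) pvec set \<times> (('a, 'n, 'd) pvec \<times> ('a, 'n, 'd) pvec) set \<Rightarrow> bool"
  for t w prec where
  zero: "(f, g) \<in> C \<Longrightarrow> is_remainder t w prec G (S_form t w prec f g) 0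
    \<Longrightarrow> buchberger_step t w prec (G, C) (G, C - {(f, g)})"
| nonzero: "(f, g) \<in> C \<Longrightarrow> is_remainder t w prec G (S_form t w prec f g) r \<Longrightarrow> r \<noteq> 0
    \<Longrightarrow> buchberger_step t w prec (G, C) (G \<union> {r}, (C - {(f, g)}) \<union> (G \<times> {r}))"

end

theory Submission
  imports Defs
begin

text \<open>
  Terms are compared by the valuation of their coefficients first, so an increasing chain of terms
  may be infinite, and when the value group is dense neither repeated reduction nor the choice of
  a representation whose smallest term is as large as possible need come to an end. The proof
  avoids both by turning them into linear algebra on finitely many monomials; homogeneity is
  what keeps the set of monomials finite.

  The basic notion is \<open>terms_above W p F\<close>: no term of \<open>F\<close> is smaller than a term of weight
  \<open>W\<close> at the monomial \<open>p\<close>. By the ultrametric inequality the families with this property form a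
  group, so such a bound survives arbitrary sums.

  \<^bold>\<open>Remainders exist.\<close> Let \<open>M\<close> be a finite set of monomials and let \<open>E\<^sub>m\<close>, for \<open>m\<close> in
  \<open>M\<close>, have initial monomial \<open>m\<close>. Modulo the maximal ideal of the valuation ring the matrix of
  the coefficients of the \<open>E\<^sub>m\<close> on \<open>M\<close>, suitably scaled, is triangular, so it can be inverted
  without leaving the valuation ring: the coefficients on \<open>M\<close> of any \<open>F\<close> can be eliminated by
  multiples \<open>a\<^sub>m E\<^sub>m\<close> none of which has a term below the initial term of \<open>F\<close> (lemma
  \<open>division\<close>). Taking for \<open>M\<close> the monomials of one degree that are divisible by some initial term
  of \<open>G\<close>, and for \<open>E\<^sub>m\<close> multiples \<open>x\<^sup>u g\<close>, gives \<open>remainder_exists\<close>.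

  \<^bold>\<open>Buchberger's criterion.\<close> Suppose that every S-form of \<open>G\<close> is a combination of \<open>G\<close> without
  terms below its own initial term. Consider the finitely many \<open>E\<^sub>j = x\<^sup>u g\<close> of degree at most
  \<open>N\<close>, and choose one of them for each initial monomial. The S-forms say that \<open>E\<^sub>j\<close> is a multiple
  of a chosen vector plus a combination of the \<open>E\<^sub>k\<close> with strictly larger initial terms. Let
  \<open>r\<^sub>j\<close> be the remainder of \<open>E\<^sub>j\<close> modulo the chosen vectors. It depends linearly on \<open>E\<^sub>j\<close>, so
  \<open>r\<^sub>j\<close> is the corresponding combination of the \<open>r\<^sub>k\<close>, and comparing weights for a \<open>j\<close> that
  minimizes the difference between the weights of \<open>r\<^sub>j\<close> and \<open>E\<^sub>j\<close> shows that all remainders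
  vanish (lemma \<open>strict_reduction_imp_span\<close>). So every \<open>F\<close> in the module is a combination of
  chosen vectors. Their initial monomials are distinct, so nothing below the initial term of \<open>F\<close>
  can cancel (\<open>buchberger_criterion\<close>), and reading off the part of the smallest weight expresses
  the initial form of \<open>F\<close> by those of \<open>G\<close> (\<open>in_form_in_span\<close>).

  \<^bold>\<open>The loop.\<close> A nonzero remainder has an initial monomial that no initial monomial of \<open>G\<close>
  divides, which by Dickson's lemma happens only finitely often, and between two such events the
  set of pairs shrinks. Adding the remainder to \<open>G\<close> also turns the division into a representation
  of the S-form by \<open>G\<close>. Hence each pair of elements of \<open>G\<close>, in one of its two orders, is either
  waiting or has an S-form represented by \<open>G\<close>, and once no pair is waiting the criterion applies.
\<close>

section \<open>Valued coefficient families\<close>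

lemma val_sum_ge:
  fixes f :: "'i \<Rightarrow> 'a::valued_field"
  assumes "\<And>i. i \<in> A \<Longrightarrow> c \<le> val (f i)"
  shows "c \<le> val (sum f A)"
  using assms(1) by (induction A rule: infinite_finite_induct) (auto intro: val_add_ge)

lemma val_diff_eq:
  fixes a b :: "'a::valued_field"
  assumes "val a < val b"
  shows "val (a - b) = val a"
proof (rule antisym)
  show "val a \<le> val (a - b)"
    using val_add_ge[of "val a" a "- b"] assms by simp
  show "val (a - b) \<le> val a"
  proof (rule ccontr)
    assume "\<not> val (a - b) \<le> val a"
    then have "val a < val ((a - b) + b)" using assms by (intro val_add_gt) auto
    then show False by simp
  qed
qed

lemma lex_least:
  fixes \<phi> :: "'j \<Rightarrow> 'b::linorder"
  assumes "finite A" "A \<noteq> {}" "\<And>i j. r i j \<Longrightarrow> \<not> r j i" "\<And>i j k. r i j \<Longrightarrow> r j k \<Longrightarrow> r i k"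
  shows "\<exists>j\<in>A. \<forall>k\<in>A. \<phi> j < \<phi> k \<or> (\<phi> j = \<phi> k \<and> \<not> r k j)"
proof -
  define R where "R i j \<longleftrightarrow> \<phi> i < \<phi> j \<or> (\<phi> i = \<phi> j \<and> r i j)" for i j
  have "\<exists>m\<in>A. \<forall>x\<in>A. x \<noteq> m \<longrightarrow> \<not> R x m"
    using assms(1) _ _ assms(2)
  proof (rule Finite_Set.bex_min_element)
    show "asymp_on A R" unfolding asymp_on_def R_def
      by (metis assms(3) order_less_asym order_less_irrefl)
    show "transp_on A R" unfolding transp_on_def R_def
      by (metis assms(4) order_less_trans)
  qed
  then show ?thesis using assms(3) unfolding R_def by (metis linorder_less_linear)
qed

definition lin_comb :: "'m set \<Rightarrow> ('m \<Rightarrow> 'i \<Rightarrow> 'a::comm_ring_1) \<Rightarrow> ('i \<Rightarrow> 'a) \<Rightarrow> bool" where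
  "lin_comb M E x \<longleftrightarrow> (\<exists>A. \<forall>i. x i = (\<Sum>m\<in>M. A m * E m i))"

lemma lin_comb_scale: "lin_comb M E x \<Longrightarrow> lin_comb M E (\<lambda>i. a * x i)"
  unfolding lin_comb_def
proof (elim exE)
  fix A assume "\<forall>i. x i = (\<Sum>m\<in>M. A m * E m i)"
  then show "\<exists>A. \<forall>i. a * x i = (\<Sum>m\<in>M. A m * E m i)"
    by (intro exI[of _ "\<lambda>m. a * A m"]) (simp add: sum_distrib_left mult.assoc)
qed

lemma lin_comb_0: "lin_comb M E (\<lambda>i. 0)"
  unfolding lin_comb_def by (rule exI[of _ "\<lambda>_. 0"]) simp

lemma lin_comb_add: "lin_comb M E x \<Longrightarrow> lin_comb M E y \<Longrightarrow> lin_comb M E (\<lambda>i. x i + y i)"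
  unfolding lin_comb_def
proof (elim exE)
  fix A B assume "\<forall>i. x i = (\<Sum>m\<in>M. A m * E m i)" "\<forall>i. y i = (\<Sum>m\<in>M. B m * E m i)"
  then show "\<exists>A. \<forall>i. x i + y i = (\<Sum>m\<in>M. A m * E m i)"
    by (intro exI[of _ "\<lambda>m. A m + B m"]) (simp add: distrib_right sum.distrib)
qed

lemma lin_comb_sum:
  "(\<And>j. j \<in> J \<Longrightarrow> lin_comb M E (x j)) \<Longrightarrow> lin_comb M E (\<lambda>i. \<Sum>j\<in>J. x j i)"
  by (induction J rule: infinite_finite_induct) (auto intro: lin_comb_0 lin_comb_add)

text \<open>The linear algebra needs only the weights of the monomials and their order, so it is carried out
  for coefficient families over an arbitrary index set of monomials.\<close>

locale valued_index =
  fixes om :: "'m \<Rightarrow> real" and lt :: "'m \<Rightarrow> 'm \<Rightarrow> bool"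
  assumes lt_irrefl: "\<not> lt m m"
    and lt_trans: "lt m m' \<Longrightarrow> lt m' m'' \<Longrightarrow> lt m m''"
    and lt_total: "m \<noteq> m' \<Longrightarrow> lt m m' \<or> lt m' m"
begin

definition tweight :: "'a::valued_field \<Rightarrow> 'm \<Rightarrow> ereal" where
  "tweight c m = val c + ereal (om m)"

text \<open>Of two terms of equal weight the one with the larger monomial is the smaller term. Therefore
  monomials beyond \<open>p\<close> must have a strictly larger weight than \<open>W\<close>, the others a weight at least \<open>W\<close>.\<close>

definition terms_above :: "ereal \<Rightarrow> 'm \<Rightarrow> ('m \<Rightarrow> 'a::valued_field) \<Rightarrow> bool" where
  "terms_above W p F \<longleftrightarrow> (\<forall>m. if lt p m then W < tweight (F m) m else W \<le> tweight (F m) m)"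

definition lead :: "('m \<Rightarrow> 'a::valued_field) \<Rightarrow> 'm \<Rightarrow> bool" where
  "lead F m \<longleftrightarrow> F m \<noteq> 0 \<and> terms_above (tweight (F m) m) m F"

lemma lt_asym: "lt m m' \<Longrightarrow> \<not> lt m' m"
  using lt_irrefl lt_trans by blast

lemma tweight_0 [simp]: "tweight 0 m = \<infinity>"
  by (simp add: tweight_def)

lemma tweight_eq_infinity_iff [simp]: "tweight c m = \<infinity> \<longleftrightarrow> c = 0"
  by (simp add: tweight_def val_eq_PInfty_iff)

lemma tweight_neq_MInfty [simp]: "tweight c m \<noteq> - \<infinity>"
  using val_neq_MInfty[of c] by (cases "val c") (auto simp: tweight_def)

lemma tweight_mult: "tweight (a * c) m = val a + tweight c m"
  by (simp add: tweight_def val_times add.assoc)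

lemma tweight_less_iff: "tweight c m < tweight d m \<longleftrightarrow> val c < val d"
  by (cases "val c"; cases "val d") (auto simp: tweight_def)

lemma tweight_add_gt: "W < tweight c m \<Longrightarrow> W < tweight d m \<Longrightarrow> W < tweight (c + d) m"
  unfolding tweight_def using val_add[of c d]
  by (metis add_right_mono min_def order_less_le_trans)

lemma tweight_add_ge: "W \<le> tweight c m \<Longrightarrow> W \<le> tweight d m \<Longrightarrow> W \<le> tweight (c + d) m"
  unfolding tweight_def using val_add[of c d]
  by (metis add_right_mono min_def order_trans)

lemma tweight_uminus [simp]: "tweight (- c) m = tweight c m"
  by (simp add: tweight_def)

lemma tweight_sum_gt:
  assumes "\<And>i. i \<in> A \<Longrightarrow> W < tweight (f i) m" "W \<noteq> \<infinity>"
  shows "W < tweight (sum f A) m"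
  using assms(1) by (induction A rule: infinite_finite_induct) (use assms(2) in \<open>auto intro: tweight_add_gt\<close>)

lemma terms_above_0 [simp]: "W \<noteq> \<infinity> \<Longrightarrow> terms_above W p (\<lambda>m. 0)"
  by (simp add: terms_above_def)

lemma terms_above_add:
  assumes "terms_above W p F" "terms_above W p G"
  shows "terms_above W p (\<lambda>m. F m + G m)"
  unfolding terms_above_def
proof
  fix m
  show "if lt p m then W < tweight (F m + G m) m else W \<le> tweight (F m + G m) m"
    using assms[unfolded terms_above_def, rule_format, of m] by (auto intro: tweight_add_gt tweight_add_ge)
qed

lemma terms_above_uminus: "terms_above W p F \<Longrightarrow> terms_above W p (\<lambda>m. - F m)"
  by (simp add: terms_above_def)

lemma terms_above_diff: "terms_above W p F \<Longrightarrow> terms_above W p G \<Longrightarrow> terms_above W p (\<lambda>m. F m - G m)"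
  using terms_above_add[of W p F "\<lambda>m. - G m"] terms_above_uminus[of W p G] by simp

lemma terms_above_sum:
  assumes "\<And>i. i \<in> A \<Longrightarrow> terms_above W p (f i)" "W \<noteq> \<infinity>"
  shows "terms_above W p (\<lambda>m. \<Sum>i\<in>A. f i m)"
  using assms(1)
  by (induction A rule: infinite_finite_induct) (use assms(2) in \<open>auto intro: terms_above_add\<close>)

lemma terms_above_trans:
  assumes "terms_above W m F" "if lt p m then V < W else V \<le> W"
  shows "terms_above V p F"
  unfolding terms_above_def
proof
  fix i
  have *: "lt m i \<Longrightarrow> W < tweight (F i) i" "W \<le> tweight (F i) i"
    using assms(1) unfolding terms_above_def by (metis order.strict_implies_order)+
  show "if lt p i then V < tweight (F i) i else V \<le> tweight (F i) i"
  proof (cases "lt p i")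
    case False
    then show ?thesis using * assms(2) by (auto split: if_splits)
  next
    case pi: True
    show ?thesis
    proof (cases "lt m i")
      case True
      then show ?thesis using * pi assms(2) by (auto split: if_splits)
    next
      case False
      then have "lt p m" using pi lt_total lt_trans by metis
      then show ?thesis using * pi assms(2) by auto
    qed
  qed
qed

lemma terms_above_scale:
  assumes "terms_above W p F" "a \<noteq> 0"
  shows "terms_above (val a + W) p (\<lambda>m. a * F m)"
proof -
  obtain r where r: "val a = ereal r"
    using assms(2) val_eq_PInfty_iff[of a] val_neq_MInfty[of a] by (cases "val a") auto
  have "ereal r + W < ereal r + t \<longleftrightarrow> W < t" "ereal r + W \<le> ereal r + t \<longleftrightarrow> W \<le> t" for t
    by (cases W; cases t; simp)+
  then show ?thesis
    using assms(1) unfolding terms_above_def tweight_mult r by simp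
qed

lemma lead_scale:
  assumes "lead F m" "a \<noteq> 0"
  shows "lead (\<lambda>i. a * F i) m"
  using assms terms_above_scale[of _ m F a] by (simp add: lead_def tweight_mult)

lemma lead_ex:
  assumes "finite {m. F m \<noteq> 0}" "F \<noteq> (\<lambda>_. 0)"
  shows "\<exists>m. lead F m"
proof -
  let ?A = "{m. F m \<noteq> 0}"
  have "\<exists>m\<in>?A. \<forall>k\<in>?A. tweight (F m) m < tweight (F k) k \<or> (tweight (F m) m = tweight (F k) k \<and> \<not> lt m k)"
    using assms by (intro lex_least) (auto intro: lt_trans dest: lt_asym)
  then obtain m where m: "F m \<noteq> 0"
    and *: "\<And>k. F k \<noteq> 0 \<Longrightarrow> tweight (F m) m < tweight (F k) k \<or> (tweight (F m) m = tweight (F k) k \<and> \<not> lt m k)"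
    by auto
  have "lead F m"
    unfolding lead_def terms_above_def
  proof (intro conjI allI m)
    fix k
    show "if lt m k then tweight (F m) m < tweight (F k) k else tweight (F m) m \<le> tweight (F k) k"
      using *[of k] m by (cases "F k = 0") auto
  qed
  then show ?thesis ..
qed

text \<open>If \<open>p\<close> comes after \<open>m\<close>, then the term at \<open>p\<close> has strictly larger weight than the leading term;
  otherwise the leading term itself has weight strictly larger than \<open>W\<close>.\<close>

lemma lead_strict:
  assumes "lead F m" "terms_above W p F" "p \<noteq> m"
  shows "W < tweight (F p) p"
proof (cases "lt m p")
  case True
  then have "tweight (F m) m < tweight (F p) p" using assms(1) by (auto simp: lead_def terms_above_def)
  moreover have "W \<le> tweight (F m) m"
    using assms(2) unfolding terms_above_def by (metis order.strict_implies_order)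
  ultimately show ?thesis by simp
next
  case False
  then have "W < tweight (F m) m" using assms lt_total by (metis terms_above_def)
  moreover have "tweight (F m) m \<le> tweight (F p) p"
    using assms(1) False unfolding lead_def terms_above_def by meson
  ultimately show ?thesis by simp
qed

text \<open>Gaussian elimination. To add a monomial \<open>s\<close> to \<open>M\<close>, first reduce \<open>E s\<close> by the other vectors; this
  leaves a vector \<open>R\<close> that vanishes on \<open>M\<close>. By \<open>lead_strict\<close> the coefficients of the subtracted
  multiples at \<open>s\<close> have larger valuation than that of \<open>E s\<close>, so \<open>R\<close> and \<open>E s\<close> have the same valuation at \<open>s\<close>, and
  \<open>R\<close> can be used to eliminate \<open>s\<close>.\<close>

lemma division:
  fixes E :: "'m \<Rightarrow> 'm \<Rightarrow> 'a::valued_field"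
  assumes "finite M" "\<And>m. m \<in> M \<Longrightarrow> lead (E m) m" "terms_above W p F" "W \<noteq> \<infinity>"
  shows "\<exists>a. (\<forall>i\<in>M. F i = (\<Sum>m\<in>M. a m * E m i)) \<and> (\<forall>m\<in>M. terms_above W p (\<lambda>i. a m * E m i))"
  using assms
proof (induction M arbitrary: W p F rule: finite_induct)
  case empty
  then show ?case by simp
next
  case (insert s M)
  let ?W = "tweight (E s s) s"
  have lead_s: "lead (E s) s" and Ess: "E s s \<noteq> 0"
    using insert.prems(1)[of s] by (auto simp: lead_def)
  have "\<exists>a. (\<forall>i\<in>M. E s i = (\<Sum>m\<in>M. a m * E m i)) \<and> (\<forall>m\<in>M. terms_above ?W s (\<lambda>i. a m * E m i))"
    using insert.prems(1) lead_s Ess by (intro insert.IH) (auto simp: lead_def)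
  then obtain a where a: "\<And>i. i \<in> M \<Longrightarrow> E s i = (\<Sum>m\<in>M. a m * E m i)"
    and a_above: "\<And>m. m \<in> M \<Longrightarrow> terms_above ?W s (\<lambda>i. a m * E m i)" by auto
  obtain b where b: "\<And>i. i \<in> M \<Longrightarrow> F i = (\<Sum>m\<in>M. b m * E m i)"
    and b_above: "\<And>m. m \<in> M \<Longrightarrow> terms_above W p (\<lambda>i. b m * E m i)"
    using insert.IH[of W p F] insert.prems by auto
  have "?W < tweight (a m * E m s) s" if "m \<in> M" for m
  proof (cases "a m = 0")
    case True
    then show ?thesis using Ess by auto
  next
    case False
    then show ?thesis
      using lead_strict[OF lead_scale[OF insert.prems(1) False] a_above] that insert.hyps by auto
  qed
  then have "?W < tweight (\<Sum>m\<in>M. a m * E m s) s"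
    using Ess by (intro tweight_sum_gt) auto
  then have val_R: "val (E s s - (\<Sum>m\<in>M. a m * E m s)) = val (E s s)"
    by (intro val_diff_eq) (simp add: tweight_less_iff)
  define R where "R i = E s i - (\<Sum>m\<in>M. a m * E m i)" for i
  define F' where "F' i = F i - (\<Sum>m\<in>M. b m * E m i)" for i
  have Rs: "R s \<noteq> 0" using val_R Ess by (metis R_def val_eq_PInfty_iff)
  define c where "c = F' s / R s"
  have cR: "c * R s = F' s" using Rs by (simp add: c_def)
  define d where "d m = (if m = s then c else b m - c * a m)" for m
  have F'_above: "terms_above W p F'"
    unfolding F'_def using insert.prems b_above by (intro terms_above_diff terms_above_sum) auto
  \<comment> \<open>The multiplier \<open>c\<close> carries the bound of \<open>E s\<close> to the size of the term of \<open>F'\<close> at \<open>s\<close>, which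
    respects the bound \<open>(W, p)\<close>.\<close>
  have scaled: "terms_above W p (\<lambda>i. c * G i)" if "terms_above ?W s G" for G
  proof (cases "c = 0")
    case False
    have "val c + ?W = tweight (F' s) s"
      using val_R cR by (metis R_def tweight_def tweight_mult)
    then have "terms_above (tweight (F' s) s) s (\<lambda>i. c * G i)"
      using terms_above_scale[OF that False] by simp
    then show ?thesis
      by (rule terms_above_trans) (use F'_above in \<open>auto simp: terms_above_def\<close>)
  qed (use insert.prems in auto)
  show ?case
  proof (intro exI conjI ballI)
    fix i assume i: "i \<in> insert s M"
    have "(\<Sum>m\<in>M. d m * E m i) = (\<Sum>m\<in>M. b m * E m i) - c * (\<Sum>m\<in>M. a m * E m i)"
      unfolding sum_distrib_left sum_subtractf[symmetric]
      using insert.hyps by (intro sum.cong) (auto simp: d_def algebra_simps)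
    then have "(\<Sum>m\<in>insert s M. d m * E m i) = c * R i + (F i - F' i)"
      using insert.hyps by (simp add: d_def R_def F'_def algebra_simps)
    moreover have "c * R i = F' i"
      using i cR a b by (auto simp: R_def F'_def)
    ultimately show "F i = (\<Sum>m\<in>insert s M. d m * E m i)" by simp
  next
    fix m assume m: "m \<in> insert s M"
    show "terms_above W p (\<lambda>i. d m * E m i)"
    proof (cases "m = s")
      case True
      then show ?thesis using scaled[of "E s"] lead_s by (auto simp: d_def lead_def)
    next
      case False
      then have "terms_above W p (\<lambda>i. b m * E m i - c * (a m * E m i))"
        using m by (intro terms_above_diff b_above scaled a_above) auto
      then show ?thesis using False by (simp add: d_def algebra_simps)
    qed
  qed
qed

text \<open>When the leading monomials are distinct, the smallest of the leading terms cannot be cancelled,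
  because all other summands have strictly larger weight at its monomial.\<close>

lemma dominant_summand:
  fixes E :: "'j \<Rightarrow> 'm \<Rightarrow> 'a::valued_field"
  assumes "finite J" "J \<noteq> {}" "inj_on mu J" and lead: "\<And>j. j \<in> J \<Longrightarrow> lead (E j) (mu j)"
  shows "\<exists>s\<in>J. tweight (\<Sum>j\<in>J. E j (mu s)) (mu s) = tweight (E s (mu s)) (mu s) \<and>
    (\<forall>j\<in>J. terms_above (tweight (E s (mu s)) (mu s)) (mu s) (E j))"
proof -
  let ?w = "\<lambda>j. tweight (E j (mu j)) (mu j)"
  have "\<exists>s\<in>J. \<forall>k\<in>J. ?w s < ?w k \<or> (?w s = ?w k \<and> \<not> lt (mu s) (mu k))"
    using assms(1,2) by (intro lex_least) (auto intro: lt_trans dest: lt_asym)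
  then obtain s where s: "s \<in> J"
    and min: "\<And>k. k \<in> J \<Longrightarrow> ?w s < ?w k \<or> (?w s = ?w k \<and> \<not> lt (mu s) (mu k))"
    by blast
  have above: "terms_above (?w s) (mu s) (E k)" if "k \<in> J" for k
    by (rule terms_above_trans[of "?w k" "mu k"]) (use min[OF that] lead[OF that] in \<open>auto simp: lead_def\<close>)
  have "?w s < tweight (E k (mu s)) (mu s)" if "k \<in> J - {s}" for k
    using lead_strict[OF lead[of k] above[of k]] that s assms(3) by (auto simp: inj_on_def)
  then have "?w s < tweight (\<Sum>k\<in>J - {s}. E k (mu s)) (mu s)"
    using lead[OF s] by (intro tweight_sum_gt) (auto simp: lead_def)
  then have "val (E s (mu s) - - (\<Sum>k\<in>J - {s}. E k (mu s))) = val (E s (mu s))"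
    by (intro val_diff_eq) (simp add: tweight_less_iff)
  then have "tweight (\<Sum>j\<in>J. E j (mu s)) (mu s) = ?w s"
    using assms(1) s by (simp add: sum.remove[of J s] tweight_def)
  then show ?thesis using above s by blast
qed

lemma terms_above_summands:
  assumes "finite J" "inj_on mu J" "\<And>j. j \<in> J \<Longrightarrow> lead (E j) (mu j)"
    and "terms_above W p (\<lambda>i. \<Sum>j\<in>J. E j i)" and "j \<in> J"
  shows "terms_above W p (E j)"
proof -
  obtain s where s: "tweight (\<Sum>j\<in>J. E j (mu s)) (mu s) = tweight (E s (mu s)) (mu s)"
    and above: "terms_above (tweight (E s (mu s)) (mu s)) (mu s) (E j)"
    using dominant_summand[OF assms(1) _ assms(2,3)] assms(5) by blast
  show ?thesis
    by (rule terms_above_trans[OF above])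
      (use assms(4)[unfolded terms_above_def, rule_format, of "mu s"] s in \<open>simp split: if_splits\<close>)
qed

lemma lead_independent:
  fixes E :: "'m \<Rightarrow> 'm \<Rightarrow> 'a::valued_field"
  assumes "finite M" "\<And>m. m \<in> M \<Longrightarrow> lead (E m) m"
    and zero: "\<And>i. i \<in> M \<Longrightarrow> (\<Sum>m\<in>M. a m * E m i) = 0"
    and "m \<in> M"
  shows "a m = 0"
proof (rule ccontr)
  assume "a m \<noteq> 0"
  let ?A = "{m\<in>M. a m \<noteq> 0}"
  have l: "lead (\<lambda>i. a k * E k i) k" if "k \<in> ?A" for k
    using that assms(2) by (auto intro: lead_scale)
  have "\<exists>s\<in>?A. tweight (\<Sum>k\<in>?A. a k * E k s) s = tweight (a s * E s s) s \<and>
      (\<forall>k\<in>?A. terms_above (tweight (a s * E s s) s) s (\<lambda>i. a k * E k i))"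
    using assms(1,4) \<open>a m \<noteq> 0\<close> l
    by (intro dominant_summand[of ?A "\<lambda>k. k" "\<lambda>k i. a k * E k i"]) auto
  then obtain s where s: "s \<in> ?A" "tweight (\<Sum>k\<in>?A. a k * E k s) s = tweight (a s * E s s) s" by blast
  have "(\<Sum>k\<in>?A. a k * E k s) = (\<Sum>k\<in>M. a k * E k s)"
    using assms(1) by (intro sum.mono_neutral_left) auto
  then have "a s * E s s = 0" using s zero[of s] by (metis mem_Collect_eq tweight_0 tweight_eq_infinity_iff)
  then show False using l[OF s(1)] by (simp add: lead_def)
qed

text \<open>A family that respects the bound \<open>(V, q)\<close> but vanishes at \<open>q\<close> has its leading term strictly above that bound.
  This is how the cancellation in an S-form turns weak inequalities into strict ones.\<close>

lemma strictly_above: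
  assumes "terms_above V q F" "F q = 0" "lead F p" "terms_above (tweight (F p) p) p H"
  shows "if lt z q then V \<le> tweight (H z) z else V < tweight (H z) z"
proof -
  have "p \<noteq> q" using assms(2,3) by (auto simp: lead_def)
  then have "if lt p q then V \<le> tweight (F p) p else V < tweight (F p) p"
    using assms(1)[unfolded terms_above_def, rule_format, of p] lt_total[of p q] lt_asym[of p q]
    by (auto split: if_splits)
  moreover have "if lt p z then tweight (F p) p < tweight (H z) z else tweight (F p) p \<le> tweight (H z) z"
    using assms(4) by (simp add: terms_above_def)
  ultimately show ?thesis
    using lt_total[of z q] lt_trans[of p q z] by (auto split: if_splits)
qed

text \<open>The summands of the combination are required to have leading terms strictly larger than a term
  of weight \<open>W\<close> at the monomial \<open>p\<close>.\<close>

definition strict_comb ::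
    "'j set \<Rightarrow> ('j \<Rightarrow> 'm \<Rightarrow> 'a::valued_field) \<Rightarrow> ('j \<Rightarrow> 'm) \<Rightarrow> ereal \<Rightarrow> 'm \<Rightarrow> ('m \<Rightarrow> 'a) \<Rightarrow> bool"
  where "strict_comb J E mu W p F \<longleftrightarrow>
    (\<exists>b. (\<forall>i. F i = (\<Sum>k\<in>J. b k * E k i)) \<and>
         (\<forall>k\<in>J. if lt (mu k) p then W \<le> tweight (b k * E k (mu k)) (mu k)
                else W < tweight (b k * E k (mu k)) (mu k)))"

lemma strict_comb_0: "W \<noteq> \<infinity> \<Longrightarrow> strict_comb J E mu W p (\<lambda>i. 0)"
  unfolding strict_comb_def by (rule exI[of _ "\<lambda>_. 0"]) auto

lemma strict_comb_add:
  assumes "strict_comb J E mu W p F" "strict_comb J E mu W p G"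
  shows "strict_comb J E mu W p (\<lambda>i. F i + G i)"
proof -
  obtain b where b: "\<And>i. F i = (\<Sum>k\<in>J. b k * E k i)"
    "\<And>k. k \<in> J \<Longrightarrow> if lt (mu k) p then W \<le> tweight (b k * E k (mu k)) (mu k)
                else W < tweight (b k * E k (mu k)) (mu k)"
    using assms(1) unfolding strict_comb_def by auto
  obtain c where c: "\<And>i. G i = (\<Sum>k\<in>J. c k * E k i)"
    "\<And>k. k \<in> J \<Longrightarrow> if lt (mu k) p then W \<le> tweight (c k * E k (mu k)) (mu k)
                else W < tweight (c k * E k (mu k)) (mu k)"
    using assms(2) unfolding strict_comb_def by auto
  show ?thesis
    unfolding strict_comb_def
  proof (intro exI[of _ "\<lambda>k. b k + c k"] conjI allI ballI)
    show "F i + G i = (\<Sum>k\<in>J. (b k + c k) * E k i)" for i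
      by (simp add: b c distrib_right sum.distrib)
    show "if lt (mu k) p then W \<le> tweight ((b k + c k) * E k (mu k)) (mu k)
        else W < tweight ((b k + c k) * E k (mu k)) (mu k)" if "k \<in> J" for k
      using b(2)[OF that] c(2)[OF that] by (auto simp: distrib_right intro: tweight_add_gt tweight_add_ge)
  qed
qed

lemma strict_comb_sum:
  assumes "\<And>x. x \<in> A \<Longrightarrow> strict_comb J E mu W p (F x)" "W \<noteq> \<infinity>"
  shows "strict_comb J E mu W p (\<lambda>i. \<Sum>x\<in>A. F x i)"
  using assms(1)
  by (induction A rule: infinite_finite_induct)
    (use assms(2) in \<open>auto intro: strict_comb_add strict_comb_0\<close>)

lemma strict_comb_single:
  assumes "finite J" "k \<in> J" "W \<noteq> \<infinity>"
    and "if lt (mu k) p then W \<le> tweight (a * E k (mu k)) (mu k) else W < tweight (a * E k (mu k)) (mu k)"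
  shows "strict_comb J E mu W p (\<lambda>i. a * E k i)"
  unfolding strict_comb_def
proof (intro exI[of _ "\<lambda>j. if j = k then a else 0"] conjI allI ballI)
  show "a * E k i = (\<Sum>j\<in>J. (if j = k then a else 0) * E j i)" for i
    using assms(1,2) by (simp add: if_distrib[of "\<lambda>x. x * _"] cong: if_cong)
qed (use assms in auto)

text \<open>If every \<open>E j\<close> agrees, up to a combination of strictly larger vectors, with a multiple of the
  vector \<open>E (c (mu j))\<close> chosen for its leading monomial, then the chosen vectors span all the others.
  Iterating the reduction would give an infinite process; instead the remainders modulo
  the chosen vectors are compared with each other.\<close>

lemma strict_reduction_imp_span:
  fixes E :: "'j \<Rightarrow> 'm \<Rightarrow> 'a::valued_field"
  assumes "finite J"
    and lead: "\<And>j. j \<in> J \<Longrightarrow> lead (E j) (mu j)"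
    and fin: "\<And>j. j \<in> J \<Longrightarrow> finite {i. E j i \<noteq> 0}"
    and c: "\<And>j. j \<in> J \<Longrightarrow> c (mu j) \<in> J \<and> mu (c (mu j)) = mu j"
    and red: "\<And>j. j \<in> J \<Longrightarrow> \<exists>\<alpha>. strict_comb J E mu (tweight (E j (mu j)) (mu j)) (mu j)
                 (\<lambda>i. E j i - \<alpha> * E (c (mu j)) i)"
    and "j \<in> J"
  shows "\<exists>a. \<forall>i. E j i = (\<Sum>m\<in>mu ` J. a m * E (c m) i)"
proof -
  let ?M = "mu ` J"
  have M: "finite ?M" using assms(1) by simp
  have lead': "lead (E (c m)) m" if "m \<in> ?M" for m
    using that lead c by force
  have "\<exists>a. \<forall>i\<in>?M. E j i = (\<Sum>m\<in>?M. a m * E (c m) i)" if "j \<in> J" for j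
    using division[of ?M "\<lambda>m. E (c m)" "tweight (E j (mu j)) (mu j)" "mu j" "E j"] M lead' lead[OF that]
    by (auto simp: lead_def)
  then obtain a where a: "\<And>j i. j \<in> J \<Longrightarrow> i \<in> ?M \<Longrightarrow> E j i = (\<Sum>m\<in>?M. a j m * E (c m) i)"
    by metis
  define r where "r j i = E j i - (\<Sum>m\<in>?M. a j m * E (c m) i)" for j i
  have r_M: "r j i = 0" if "j \<in> J" "i \<in> ?M" for j i
    using a that by (simp add: r_def)
  have indep: "(\<Sum>m\<in>?M. A m * E (c m) i) = 0" if "\<And>i. i \<in> ?M \<Longrightarrow> (\<Sum>m\<in>?M. A m * E (c m) i) = 0" for A i
  proof (intro sum.neutral ballI)
    fix m assume "m \<in> ?M"
    have "A m = 0"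
      by (rule lead_independent[where M = ?M and E = "\<lambda>m. E (c m)"])
        (fact M lead' that \<open>m \<in> ?M\<close>)+
    then show "A m * E (c m) i = 0" by simp
  qed
  have "\<exists>b. (\<forall>i. r j i = (\<Sum>k\<in>J. b k * r k i)) \<and>
         (\<forall>k\<in>J. if lt (mu k) (mu j) then tweight (E j (mu j)) (mu j) \<le> tweight (b k * E k (mu k)) (mu k)
                else tweight (E j (mu j)) (mu j) < tweight (b k * E k (mu k)) (mu k))" if j: "j \<in> J" for j
  proof -
    obtain \<alpha> b where b: "\<And>i. E j i - \<alpha> * E (c (mu j)) i = (\<Sum>k\<in>J. b k * E k i)"
      and b': "\<forall>k\<in>J. if lt (mu k) (mu j) then tweight (E j (mu j)) (mu j) \<le> tweight (b k * E k (mu k)) (mu k)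
                else tweight (E j (mu j)) (mu j) < tweight (b k * E k (mu k)) (mu k)"
      using red[OF j] unfolding strict_comb_def by (elim exE conjE) (rule that, auto)
    define A where "A m = (if m = mu j then \<alpha> else 0) - a j m + (\<Sum>k\<in>J. b k * a k m)" for m
    \<comment> \<open>The difference lies in the span of the chosen vectors, where only \<open>0\<close> vanishes on all leading
      monomials.\<close>
    have diff: "r j i - (\<Sum>k\<in>J. b k * r k i) = (\<Sum>m\<in>?M. A m * E (c m) i)" for i
    proof -
      have 1: "(\<Sum>m\<in>?M. (if m = mu j then \<alpha> else 0) * E (c m) i) = \<alpha> * E (c (mu j)) i"
        using M j by (simp add: if_distrib[of "\<lambda>x. x * _"] cong: if_cong)
      have 2: "(\<Sum>m\<in>?M. (\<Sum>k\<in>J. b k * a k m) * E (c m) i)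
          = (\<Sum>k\<in>J. b k * (\<Sum>m\<in>?M. a k m * E (c m) i))"
        by (simp add: sum_distrib_left sum_distrib_right mult.assoc) (rule sum.swap)
      have 3: "(\<Sum>m\<in>?M. A m * E (c m) i) = \<alpha> * E (c (mu j)) i - (\<Sum>m\<in>?M. a j m * E (c m) i)
          + (\<Sum>k\<in>J. b k * (\<Sum>m\<in>?M. a k m * E (c m) i))"
        by (simp only: A_def left_diff_distrib distrib_right sum.distrib sum_subtractf 1 2)
      have 4: "(\<Sum>k\<in>J. b k * r k i)
          = (\<Sum>k\<in>J. b k * E k i) - (\<Sum>k\<in>J. b k * (\<Sum>m\<in>?M. a k m * E (c m) i))"
        by (simp only: r_def right_diff_distrib sum_subtractf)
      show ?thesis unfolding 3 4 b[of i, symmetric] r_def[of j i] by simp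
    qed
    have "(\<Sum>m\<in>?M. A m * E (c m) i) = 0" for i
      by (rule indep) (use r_M j in \<open>simp flip: diff\<close>)
    then show ?thesis using diff b' by (intro exI[of _ b]) auto
  qed
  then have "\<exists>b. \<forall>j\<in>J. (\<forall>i. r j i = (\<Sum>k\<in>J. b j k * r k i)) \<and>
         (\<forall>k\<in>J. if lt (mu k) (mu j) then tweight (E j (mu j)) (mu j) \<le> tweight (b j k * E k (mu k)) (mu k)
                else tweight (E j (mu j)) (mu j) < tweight (b j k * E k (mu k)) (mu k))"
    by (intro bchoice) blast
  then obtain b where b: "\<And>j i. j \<in> J \<Longrightarrow> r j i = (\<Sum>k\<in>J. b j k * r k i)"
    and b_strict: "\<And>j k. j \<in> J \<Longrightarrow> k \<in> J \<Longrightarrow>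
         if lt (mu k) (mu j) then tweight (E j (mu j)) (mu j) \<le> tweight (b j k * E k (mu k)) (mu k)
         else tweight (E j (mu j)) (mu j) < tweight (b j k * E k (mu k)) (mu k)"
    by blast
  have "r j = (\<lambda>_. 0)" if "j \<in> J" for j
  proof (rule ccontr)
    assume rj: "r j \<noteq> (\<lambda>_. 0)"
    let ?A = "{j\<in>J. r j \<noteq> (\<lambda>_. 0)}"
    have "finite {i. r j i \<noteq> 0}" if "j \<in> J" for j
    proof (rule finite_subset)
      show "{i. r j i \<noteq> 0} \<subseteq> {i. E j i \<noteq> 0} \<union> (\<Union>m\<in>?M. {i. E (c m) i \<noteq> 0})"
        by (auto simp: r_def elim!: sum.not_neutral_contains_not_neutral)
      show "finite \<dots>" using fin c \<open>finite J\<close> that by auto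
    qed
    then have "\<forall>j\<in>?A. \<exists>q. lead (r j) q" using lead_ex by blast
    then have "\<exists>q. \<forall>j\<in>?A. lead (r j) (q j)" by (rule bchoice)
    then obtain q where q: "\<And>j. j \<in> ?A \<Longrightarrow> lead (r j) (q j)" by blast
    define \<rho> where "\<rho> j = real_of_ereal (tweight (r j (q j)) (q j))" for j
    define \<delta> where "\<delta> j = real_of_ereal (tweight (E j (mu j)) (mu j))" for j
    have \<rho>: "tweight (r j (q j)) (q j) = ereal (\<rho> j)" if "j \<in> ?A" for j
      using q[OF that] unfolding \<rho>_def lead_def by (subst ereal_real') auto
    have \<delta>: "tweight (E j (mu j)) (mu j) = ereal (\<delta> j)" if "j \<in> J" for j
      using lead[OF that] unfolding \<delta>_def lead_def by (subst ereal_real') auto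
    \<comment> \<open>Multiplying by \<open>b j k\<close> shifts both weights alike, so the differences \<open>\<rho> - \<delta>\<close> can be compared; a tie
      in them is broken by the smallest leading monomial, since a summand of equal weight has a smaller one.\<close>
    have "\<exists>j\<in>?A. \<forall>k\<in>?A. \<rho> j - \<delta> j < \<rho> k - \<delta> k \<or>
        (\<rho> j - \<delta> j = \<rho> k - \<delta> k \<and> \<not> lt (mu k) (mu j))"
      using assms(1) rj \<open>j \<in> J\<close> by (intro lex_least) (auto intro: lt_trans dest: lt_asym)
    then obtain j where j: "j \<in> ?A"
      and min: "\<And>k. k \<in> ?A \<Longrightarrow> \<rho> j - \<delta> j < \<rho> k - \<delta> k \<or>
        (\<rho> j - \<delta> j = \<rho> k - \<delta> k \<and> \<not> lt (mu k) (mu j))" by blast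
    have "ereal (\<rho> j) < tweight (b j k * r k (q j)) (q j)" if k: "k \<in> J" for k
    proof (cases "b j k = 0 \<or> r k = (\<lambda>_. 0)")
      case True
      then show ?thesis by auto
    next
      case False
      then have kA: "k \<in> ?A" using k by simp
      obtain \<beta> where \<beta>: "val (b j k) = ereal \<beta>"
        using False val_eq_PInfty_iff[of "b j k"] val_neq_MInfty[of "b j k"]
        by (cases "val (b j k)") auto
      have "if lt (mu k) (mu j) then \<delta> j \<le> \<beta> + \<delta> k else \<delta> j < \<beta> + \<delta> k"
        using b_strict[of j k] j k \<delta>[of j] by (simp only: tweight_mult \<beta> \<delta>[OF k]) (simp split: if_splits)
      then have "\<rho> j < \<beta> + \<rho> k" using min[OF kA] by (auto split: if_splits)
      then have "ereal (\<rho> j) < ereal \<beta> + ereal (\<rho> k)" by simp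
      also have "ereal (\<rho> k) \<le> tweight (r k (q j)) (q j)"
        using q[OF kA] \<rho>[OF kA] unfolding lead_def terms_above_def
        by (metis order.strict_implies_order)
      then have "ereal \<beta> + ereal (\<rho> k) \<le> tweight (b j k * r k (q j)) (q j)"
        unfolding tweight_mult \<beta> by (rule add_left_mono)
      finally show ?thesis .
    qed
    then have "ereal (\<rho> j) < tweight (\<Sum>k\<in>J. b j k * r k (q j)) (q j)"
      by (intro tweight_sum_gt) auto
    then show False using \<rho>[OF j] b[of j "q j"] j by simp
  qed
  then have "\<And>i. r j i = 0" using \<open>j \<in> J\<close> by metis
  then show ?thesis by (intro exI[of _ "a j"]) (simp add: r_def)
qed

end

section \<open>Coefficients of polynomial vectors\<close>

definition shift :: "'n expo \<Rightarrow> 'n expo \<times> 'd \<Rightarrow> 'n expo \<times> 'd" where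
  "shift u m = (u + fst m, snd m)"

abbreviation tmult :: "'a::comm_ring_1 \<Rightarrow> 'n expo \<Rightarrow> ('a, 'n, 'd::finite) pvec \<Rightarrow> ('a, 'n, 'd) pvec" where
  "tmult a u f \<equiv> Poly_Mapping.single u a *s f"

lemma fst_shift [simp]: "fst (shift u m) = u + fst m"
  and snd_shift [simp]: "snd (shift u m) = snd m"
  by (simp_all add: shift_def)

lemma shift_shift: "shift u (shift v m) = shift (u + v) m"
  by (simp add: shift_def add.assoc)

lemma shift_inject [simp]: "shift u m = shift u m' \<longleftrightarrow> m = m'"
  by (auto simp: shift_def prod_eq_iff)

lemma coef_0 [simp]: "coef 0 m = 0"
  by (simp add: coef_def)

lemma coef_diff: "coef (f - g) m = coef f m - (coef g m :: 'a::ab_group_add)"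
  by (simp add: coef_def lookup_minus)

lemma coef_uminus: "coef (- f) m = - (coef f m :: 'a::ab_group_add)"
  by (simp add: coef_def)

lemma coef_sum: "coef (\<Sum>i\<in>A. f i) m = (\<Sum>i\<in>A. coef (f i) m)"
  by (simp add: coef_def lookup_sum)

lemma pvec_eqI: "(\<And>m. coef f m = coef g m) \<Longrightarrow> f = g"
  by (auto simp: vec_eq_iff coef_def intro!: poly_mapping_eqI)

lemma coef_eq_0_iff: "coef f = (\<lambda>_. 0) \<longleftrightarrow> f = 0"
  by (auto intro!: pvec_eqI simp: fun_eq_iff)

lemma coef_mterm: "coef (mterm c m) m' = (if m' = m then c else 0)"
  by (auto simp: coef_def mterm_def axis_def lookup_single when_def prod_eq_iff)

lemma finite_supp: "finite (supp f)"
proof (rule finite_subset)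
  show "supp f \<subseteq> (\<Union>k\<in>UNIV. (\<lambda>u. (u, k)) ` Poly_Mapping.keys (f $ k))"
    by (force simp: supp_def coef_def in_keys_iff)
qed simp

lemma finite_coef_neq_0: "finite {m. coef f m \<noteq> 0}"
  using finite_supp[of f] by (simp add: supp_def)

lemma lookup_single_times:
  fixes p :: "('a::comm_ring_1, 'n) mpoly"
  shows "Poly_Mapping.lookup (Poly_Mapping.single u a * p) (u + v) = a * Poly_Mapping.lookup p v"
  by (simp add: lookup_mult lookup_single when_mult)

lemma lookup_single_times_eq_0:
  fixes p :: "('a::comm_ring_1, 'n) mpoly"
  assumes "\<And>v. k \<noteq> u + v"
  shows "Poly_Mapping.lookup (Poly_Mapping.single u a * p) k = 0"
  using assms by (simp add: lookup_mult lookup_single when_mult)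

lemma coef_tmult_shift [simp]: "coef (tmult a u f) (shift u m) = a * coef f m"
  by (simp add: coef_def shift_def lookup_single_times)

lemma coef_tmult_eq_0: "(\<And>m'. m \<noteq> shift u m') \<Longrightarrow> coef (tmult a u f) m = 0"
  unfolding coef_def vector_smult_component
  by (rule lookup_single_times_eq_0) (metis fst_shift snd_shift prod.collapse fst_conv snd_conv)

lemma coef_tmult_cases:
  obtains m' where "m = shift u m'" "coef (tmult a u f) m = a * coef f m'"
  | "\<And>m'. m \<noteq> shift u m'" "coef (tmult a u f) m = 0"
  by (metis coef_tmult_eq_0 coef_tmult_shift)

lemma coef_tmult_0: "coef (tmult a 0 f) m = a * coef f m"
  using coef_tmult_shift[where u = 0] by (simp add: shift_def)

lemma tmult_tmult: "tmult a u (tmult b v f) = tmult (a * b) (u + v) f"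
  by (simp add: mult_single)

lemma tmult_mterm: "tmult a u (mterm b m) = mterm (a * b) (shift u m)"
  by (auto simp: mterm_def shift_def axis_def vec_eq_iff mult_single)

lemma mpoly_eq_sum_single:
  "p = (\<Sum>u\<in>Poly_Mapping.keys p. Poly_Mapping.single u (Poly_Mapping.lookup p u))"
  by (rule poly_mapping_eqI)
    (simp add: lookup_sum lookup_single when_def in_keys_iff)

lemma smult_eq_sum_tmult:
  "p *s f = (\<Sum>u\<in>Poly_Mapping.keys p. tmult (Poly_Mapping.lookup p u) u f)"
  by (subst mpoly_eq_sum_single[of p]) (rule pvec.scale_sum_left)

section \<open>Degrees\<close>

lemma deg_add: "deg (u + v) = deg u + deg v"
  by (simp add: deg_def lookup_add sum.distrib)

lemma finite_deg_le: "finite {u :: 'n::finite expo. deg u \<le> N}"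
proof -
  have "finite (PiE (UNIV :: 'n set) (\<lambda>_. {..N}))"
    by (intro finite_PiE) auto
  moreover have "Poly_Mapping.lookup ` {u :: 'n expo. deg u \<le> N} \<subseteq> PiE UNIV (\<lambda>_. {..N})"
  proof (clarsimp simp: PiE_def Pi_def)
    fix u :: "'n expo" and i assume "deg u \<le> N"
    moreover have "Poly_Mapping.lookup u i \<le> deg u"
      unfolding deg_def by (rule member_le_sum) auto
    ultimately show "Poly_Mapping.lookup u i \<le> N" by simp
  qed
  ultimately have "finite (Poly_Mapping.lookup ` {u :: 'n expo. deg u \<le> N})"
    by (rule rev_finite_subset)
  then show ?thesis
    by (rule finite_imageD) (auto intro!: inj_onI poly_mapping_eqI)
qed

lemma homogeneous_of_iff: "homogeneous_of e f \<longleftrightarrow> (\<forall>m. coef f m \<noteq> 0 \<longrightarrow> deg (fst m) = e)"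
  by (auto simp: homogeneous_of_def supp_def)

lemma homogeneous_of_0: "homogeneous_of e 0"
  by (simp add: homogeneous_of_iff)

lemma homogeneous_of_diff:
  "homogeneous_of e f \<Longrightarrow> homogeneous_of e g
    \<Longrightarrow> homogeneous_of e (f - g :: ('a::ab_group_add, 'n::finite, 'd::finite) pvec)"
  unfolding homogeneous_of_iff coef_diff by (metis diff_zero)

lemma homogeneous_of_sum:
  assumes "\<And>i. i \<in> A \<Longrightarrow> homogeneous_of e (f i)"
  shows "homogeneous_of e (\<Sum>i\<in>A. f i)"
  using assms unfolding homogeneous_of_iff coef_sum
  by (metis sum.not_neutral_contains_not_neutral)

lemma homogeneous_of_tmult:
  assumes "homogeneous_of e f"
  shows "homogeneous_of (deg u + e) (tmult a u f)"
  unfolding homogeneous_of_iff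
proof (intro allI impI)
  fix m assume nz: "coef (tmult a u f) m \<noteq> 0"
  show "deg (fst m) = deg u + e"
  proof (cases rule: coef_tmult_cases[of m u a f])
    case (1 m')
    then have "coef f m' \<noteq> 0" using nz by auto
    then show ?thesis
      using assms[unfolded homogeneous_of_iff, rule_format, of m'] 1(1) by (simp add: deg_add)
  qed (use nz in simp)
qed

section \<open>Leading monomials and initial terms\<close>

lemma weight_add: "weight w (u + v) = weight w u + weight w v"
  by (simp add: weight_def lookup_add distrib_left sum.distrib)

text \<open>The parameter \<open>d_type\<close> only fixes the type that indexes the basis vectors.\<close>

locale valued_order =
  fixes t :: "real \<Rightarrow> 'a::valued_field"
    and w :: "real ^ 'n::finite"
    and prec :: "'n expo \<Rightarrow> 'n expo \<Rightarrow> bool"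
    and d_type :: "'d::{finite,linorder} itself"
  assumes t_section: "val_section t"
    and w_in_group: "\<And>i. w $ i \<in> value_group TYPE('a)"
    and mono_order: "monomial_order prec"
begin

sublocale valued_index "\<lambda>m :: 'n expo \<times> 'd. weight w (fst m)" "mono_less prec"
proof
  fix m m' m'' :: "'n expo \<times> 'd"
  have irr: "\<not> prec u u" and tr: "prec u v \<Longrightarrow> prec v v' \<Longrightarrow> prec u v'"
    and tot: "u \<noteq> v \<Longrightarrow> prec u v \<or> prec v u" for u v v'
    using mono_order by (auto simp: monomial_order_def irreflp_def transp_def totalp_on_def)
  show "\<not> mono_less prec m m"
    by (simp add: mono_less_def irr)
  show "mono_less prec m m' \<Longrightarrow> mono_less prec m' m'' \<Longrightarrow> mono_less prec m m''"
    unfolding mono_less_def by (elim disjE conjE) (auto dest: tr)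
  show "m \<noteq> m' \<Longrightarrow> mono_less prec m m' \<or> mono_less prec m' m"
    using tot[of "fst m" "fst m'"]
    by (cases "fst m = fst m'") (auto simp: mono_less_def prod_eq_iff)
qed

lemma mono_less_shift: "mono_less prec (shift u m) (shift u m') \<longleftrightarrow> mono_less prec m (m' :: 'n expo \<times> 'd)"
proof -
  have imp: "mono_less prec (shift u m) (shift u m')" if "mono_less prec m m'" for m m' :: "'n expo \<times> 'd"
    using that mono_order unfolding mono_less_def monomial_order_def by (auto simp: add.commute[of u])
  show ?thesis using imp lt_total lt_asym shift_inject by metis
qed

lemma tweight_shift: "tweight c (shift u m) = tweight c m + ereal (weight w u)"
  by (cases "val c") (auto simp: tweight_def weight_add)

lemma terms_above_tmult:
  assumes "terms_above W p (coef f)" "a \<noteq> 0" "W \<noteq> \<infinity>"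
  shows "terms_above (val a + ereal (weight w u) + W) (shift u p) (coef (tmult a u f))"
  unfolding terms_above_def
proof
  fix m :: "'n expo \<times> 'd"
  obtain r where r: "val a = ereal r"
    using assms(2) val_eq_PInfty_iff[of a] val_neq_MInfty[of a] by (cases "val a") auto
  have *: "ereal (r + q) + W < x + ereal q + ereal r \<longleftrightarrow> W < x"
    "ereal (r + q) + W \<le> x + ereal q + ereal r \<longleftrightarrow> W \<le> x" for q x
    by (cases W; cases x; simp)+
  show "if mono_less prec (shift u p) m
    then val a + ereal (weight w u) + W < tweight (coef (tmult a u f) m) m
    else val a + ereal (weight w u) + W \<le> tweight (coef (tmult a u f) m) m"
  proof (cases rule: coef_tmult_cases[of m u a f])
    case (1 m')
    have "tweight (coef (tmult a u f) m) m = tweight (coef f m') m' + ereal (weight w u) + ereal r"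
      unfolding 1(2) tweight_mult r by (simp only: 1(1) tweight_shift add.commute)
    then show ?thesis
      using assms(1)[unfolded terms_above_def, rule_format, of m'] 1(1) r *
      by (simp add: mono_less_shift)
  next
    case 2
    have "tweight (coef (tmult a u f) m) m = \<infinity>" using 2 by simp
    then show ?thesis using r assms(3) by auto
  qed
qed

lemma lead_tmult:
  assumes "lead (coef f) m" "a \<noteq> 0"
  shows "lead (coef (tmult a u f)) (shift u m)"
proof -
  have "terms_above (val a + ereal (weight w u) + tweight (coef f m) m) (shift u m) (coef (tmult a u f))"
    using assms by (intro terms_above_tmult) (auto simp: lead_def)
  moreover have "val a + ereal (weight w u) + tweight (coef f m) m = tweight (a * coef f m) (shift u m)"
    by (simp only: tweight_mult tweight_shift add.assoc) (simp only: add.commute)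
  ultimately show ?thesis
    using assms by (simp add: lead_def)
qed

lemma value_group_0: "0 \<in> value_group TYPE('a)"
  unfolding value_group_def using val_1 by (auto intro!: exI[of _ 1])

lemma value_group_add:
  assumes "\<gamma> \<in> value_group TYPE('a)" "\<delta> \<in> value_group TYPE('a)"
  shows "\<gamma> + \<delta> \<in> value_group TYPE('a)"
proof -
  obtain a b :: 'a where "a \<noteq> 0" "val a = ereal \<gamma>" "b \<noteq> 0" "val b = ereal \<delta>"
    using assms by (auto simp: value_group_def)
  then show ?thesis
    unfolding value_group_def by (auto intro!: exI[of _ "a * b"] simp: val_times)
qed

lemma value_group_uminus:
  assumes "\<gamma> \<in> value_group TYPE('a)"
  shows "- \<gamma> \<in> value_group TYPE('a)"
proof -
  obtain a :: 'a where "a \<noteq> 0" "val a = ereal \<gamma>"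
    using assms by (auto simp: value_group_def)
  then show ?thesis
    unfolding value_group_def by (auto intro!: exI[of _ "inverse a"] simp: val_inverse)
qed

lemma val_in_group:
  assumes "c \<noteq> (0 :: 'a)"
  shows "real_of_ereal (val c) \<in> value_group TYPE('a)"
    and "ereal (real_of_ereal (val c)) = val c"
proof -
  obtain r where r: "val c = ereal r"
    using assms val_eq_PInfty_iff[of c] val_neq_MInfty[of c] by (cases "val c") auto
  then show "real_of_ereal (val c) \<in> value_group TYPE('a)" "ereal (real_of_ereal (val c)) = val c"
    using assms by (auto simp: value_group_def)
qed

lemma value_group_sum:
  "(\<And>i. i \<in> A \<Longrightarrow> f i \<in> value_group TYPE('a)) \<Longrightarrow> sum f A \<in> value_group TYPE('a)"
  by (induction A rule: infinite_finite_induct) (auto intro: value_group_0 value_group_add)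

lemma value_group_of_nat_mult:
  "\<gamma> \<in> value_group TYPE('a) \<Longrightarrow> \<gamma> * real k \<in> value_group TYPE('a)"
  by (induction k) (auto simp: distrib_left intro: value_group_0 value_group_add)

lemma weight_in_group: "weight w u \<in> value_group TYPE('a)"
  unfolding weight_def by (intro value_group_sum value_group_of_nat_mult w_in_group)

lemma val_t:
  assumes "\<gamma> \<in> value_group TYPE('a)"
  shows "t \<gamma> \<noteq> 0" "val (t \<gamma>) = ereal \<gamma>"
  using t_section assms by (auto simp: val_section_def)

lemma t_add:
  "\<gamma> \<in> value_group TYPE('a) \<Longrightarrow> \<delta> \<in> value_group TYPE('a) \<Longrightarrow> t (\<gamma> + \<delta>) = t \<gamma> * t \<delta>"
  using t_section by (auto simp: val_section_def)

lemma val_normalized: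
  assumes "c \<noteq> (0 :: 'a)"
  shows "val (c * t (- real_of_ereal (val c))) = 0"
proof -
  have "val (t (- real_of_ereal (val c))) = - ereal (real_of_ereal (val c))"
    using val_t(2)[OF value_group_uminus[OF val_in_group(1)[OF assms]]] by simp
  also have "\<dots> = - val c" by (simp only: val_in_group(2)[OF assms])
  finally show ?thesis
    using assms val_eq_PInfty_iff[of c] val_neq_MInfty[of c] by (cases "val c") (auto simp: val_times)
qed

lemma abs_residue_eq_0_iff: "0 \<le> val (a :: 'a) \<Longrightarrow> abs_residue a = 0 \<longleftrightarrow> 0 < val a"
  using Quotient3_rel[OF Quotient3_residue, of a 0] by (simp add: zero_residue.abs_eq)

lemma coef_in_form:
  "coef (in_form t w f) m =
    (if m \<in> supp f \<and> tweight (coef f m) m = min_weight w f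
     then abs_residue (coef f m * t (- real_of_ereal (val (coef f m)))) else 0)"
proof -
  let ?A = "{m. m \<in> supp f \<and> tweight (coef f m) m = min_weight w f}"
  have "finite ?A" using finite_supp[of f] by (rule rev_finite_subset) auto
  then show ?thesis
    unfolding in_form_def coef_sum coef_mterm tweight_def by simp
qed

lemma supp_in_form:
  "supp (in_form t w f) = {m\<in>supp f. tweight (coef f m) m = min_weight w f}"
proof -
  have "abs_residue (coef f m * t (- real_of_ereal (val (coef f m)))) \<noteq> 0" if "m \<in> supp f" for m
    using that val_normalized[of "coef f m"] by (simp add: supp_def abs_residue_eq_0_iff)
  then show ?thesis by (auto simp: supp_def[of "in_form t w f"] coef_in_form)
qed

lemma min_weight_eq:
  assumes "lead (coef f) m"
  shows "min_weight w f = tweight (coef f m) m"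
  unfolding min_weight_def
proof (rule Min_eqI)
  fix y assume "y \<in> (\<lambda>m. val (coef f m) + ereal (weight w (fst m))) ` supp f"
  then obtain m' where "y = tweight (coef f m') m'" by (auto simp: tweight_def)
  then show "tweight (coef f m) m \<le> y"
    using assms unfolding lead_def terms_above_def by (metis order.strict_implies_order)
qed (use assms finite_supp[of f] in \<open>auto simp: lead_def supp_def tweight_def\<close>)

lemma in_mono_eq:
  assumes "lead (coef f) m"
  shows "in_mono t w prec f = m"
  unfolding in_mono_def supp_in_form min_weight_eq[OF assms]
proof (rule the_equality, intro conjI)
  let ?A = "{m' \<in> supp f. tweight (coef f m') m' = tweight (coef f m) m}"
  show m: "m \<in> ?A" using assms by (simp add: lead_def supp_def)
  show less: "\<forall>m'\<in>?A. m' \<noteq> m \<longrightarrow> mono_less prec m' m"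
  proof (intro ballI impI)
    fix m' assume m': "m' \<in> ?A" "m' \<noteq> m"
    have "\<not> mono_less prec m m'"
    proof
      assume "mono_less prec m m'"
      then have "tweight (coef f m) m < tweight (coef f m') m'"
        using assms by (simp add: lead_def terms_above_def del: split_paired_All)
      then show False using m'(1) by simp
    qed
    then show "mono_less prec m' m" using lt_total m'(2) by blast
  qed
  fix m' assume m': "m' \<in> ?A \<and> (\<forall>m''\<in>?A. m'' \<noteq> m' \<longrightarrow> mono_less prec m'' m')"
  show "m' = m"
  proof (rule ccontr)
    assume "m' \<noteq> m"
    then have "mono_less prec m' m" "mono_less prec m m'"
      using bspec[OF less conjunct1[OF m']] bspec[OF conjunct2[OF m'] m] by simp_all
    then show False by (simp add: lt_asym)
  qed
qed

lemma lead_in_mono: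
  assumes "f \<noteq> 0"
  shows "lead (coef f) (in_mono t w prec f :: 'n expo \<times> 'd)"
proof -
  obtain m where "lead (coef f) m"
    using lead_ex[of "coef f"] finite_coef_neq_0 assms by (auto simp: coef_eq_0_iff)
  then show ?thesis using in_mono_eq by metis
qed

lemma coef_in_mono: "f \<noteq> 0 \<Longrightarrow> coef f (in_mono t w prec f :: 'n expo \<times> 'd) \<noteq> 0"
  using lead_in_mono[of f] by (simp add: lead_def)

end

section \<open>Terms, divisibility and quotients\<close>

text \<open>Monomials are pairs, but quantifiers over them are best left unsplit.\<close>

declare split_paired_All [simp del] split_paired_Ex [simp del]

lemma mterm_eq_0_iff [simp]: "mterm c m = 0 \<longleftrightarrow> c = 0"
proof
  assume "mterm c m = 0"
  then have "coef (mterm c m) m = 0" by simp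
  then show "c = 0" by (simp add: coef_mterm)
qed (auto intro!: pvec_eqI simp: coef_mterm)

lemma mterm_inject: "a \<noteq> 0 \<Longrightarrow> mterm a m = mterm b m' \<longleftrightarrow> a = b \<and> m = m'"
  by (metis coef_mterm)

lemma lookup_lcm_expo:
  "Poly_Mapping.lookup (lcm_expo u v) i = max (Poly_Mapping.lookup u i) (Poly_Mapping.lookup v i)"
  by (simp add: lcm_expo_def lookup_sum lookup_single when_def)

lemma expo_add_diff:
  assumes "\<And>i. Poly_Mapping.lookup u i \<le> Poly_Mapping.lookup v i"
  shows "v = (v - u) + (u :: 'n expo)"
  using assms by (intro poly_mapping_eqI) (simp add: lookup_add lookup_minus)

lemma lcm_expo_left: "lcm_expo u v = (lcm_expo u v - u) + u"
  and lcm_expo_right: "lcm_expo u v = (lcm_expo u v - v) + v"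
  by (rule expo_add_diff, simp add: lookup_lcm_expo)+

lemma lcm_expo_least:
  assumes "a + u = b + (v :: 'n::finite expo)"
  obtains s where "a = s + (lcm_expo u v - u)" "b = s + (lcm_expo u v - v)"
proof -
  let ?l = "lcm_expo u v"
  define s where "s = a + u - ?l"
  have "Poly_Mapping.lookup ?l i \<le> Poly_Mapping.lookup (a + u) i" for i
    using arg_cong[OF assms, of "\<lambda>x. Poly_Mapping.lookup x i"]
    by (simp add: lookup_lcm_expo lookup_add)
  then have s: "a + u = s + ?l" unfolding s_def by (rule expo_add_diff)
  have "a + u = (s + (?l - u)) + u"
    using s lcm_expo_left[of u v] by (simp add: add.assoc)
  moreover have "b + v = (s + (?l - v)) + v"
    using s assms lcm_expo_right[of u v] by (simp add: add.assoc)
  ultimately show ?thesis using that by (metis add_right_cancel)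
qed

lemma term_dvd_iff:
  "term_dvd (mterm b m) (mterm (1 :: 'a::field) m') \<longleftrightarrow> b \<noteq> 0 \<and> (\<exists>u. m' = shift u m)"
proof
  assume "term_dvd (mterm b m) (mterm 1 m')"
  then obtain b' \<beta> a \<alpha> i where *: "b' \<noteq> 0" "mterm b m = mterm b' (\<beta>, i)" "mterm 1 m' = mterm a (\<alpha>, i)"
    "Poly_Mapping.single \<beta> b' dvd Poly_Mapping.single \<alpha> a"
    unfolding term_dvd_def by blast
  have m': "a = 1" "m' = (\<alpha>, i)" using *(3) by (auto simp: mterm_inject)
  have m: "b = b'" "m = (\<beta>, i)" using *(1) *(2)[symmetric] by (auto simp: mterm_inject)
  obtain q where "Poly_Mapping.single \<alpha> a = Poly_Mapping.single \<beta> b' * q" using *(4) by (elim dvdE)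
  then have "Poly_Mapping.lookup (Poly_Mapping.single \<beta> b' * q) \<alpha> \<noteq> 0"
    using m' by (metis lookup_single_eq zero_neq_one)
  then obtain u where "\<alpha> = \<beta> + u" using lookup_single_times_eq_0 by metis
  then show "b \<noteq> 0 \<and> (\<exists>u. m' = shift u m)"
    using m m' *(1) by (auto simp: shift_def add.commute)
next
  assume "b \<noteq> 0 \<and> (\<exists>u. m' = shift u m)"
  then obtain u where b: "b \<noteq> 0" and m': "m' = (u + fst m, snd m)" by (auto simp: shift_def)
  have "Poly_Mapping.single (u + fst m) 1 = Poly_Mapping.single (fst m) b * Poly_Mapping.single u (inverse b)"
    using b by (simp add: mult_single add.commute)
  then have "Poly_Mapping.single (fst m) b dvd Poly_Mapping.single (u + fst m) (1 :: 'a)" by (rule dvdI)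
  then show "term_dvd (mterm b m) (mterm 1 m')"
    unfolding term_dvd_def using b m'
    by (intro exI[of _ b] exI[of _ "fst m"] exI[of _ 1] exI[of _ "u + fst m"] exI[of _ "snd m"]) auto
qed

lemma term_quot_eq:
  assumes "c \<noteq> (0 :: 'a::field)"
  shows "term_quot (mterm 1 (shift u m)) (mterm c m) = Poly_Mapping.single u (inverse c)"
  unfolding term_quot_def
proof (rule the_equality)
  show "(\<exists>a v. Poly_Mapping.single u (inverse c) = Poly_Mapping.single v a) \<and>
    tmult (inverse c) u (mterm c m) = mterm 1 (shift u m)"
    using assms by (auto simp: tmult_mterm)
  fix q assume "(\<exists>a v. q = Poly_Mapping.single v a) \<and> q *s mterm c m = mterm 1 (shift u m)"
  then obtain a v where q: "q = Poly_Mapping.single v a" and "mterm 1 (shift u m) = mterm (a * c) (shift v m)"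
    by (auto simp: tmult_mterm)
  then have ac: "a * c = 1" and "shift u m = shift v m" by (auto simp: mterm_inject)
  moreover have "a = inverse c" using ac assms by (simp add: inverse_eq_divide eq_divide_eq)
  ultimately show "q = Poly_Mapping.single u (inverse c)"
    using q by (auto simp: shift_def)
qed

context valued_order
begin

lemma min_weight_in_mono:
  "f \<noteq> 0 \<Longrightarrow> min_weight w f = tweight (coef f (in_mono t w prec f)) (in_mono t w prec f :: 'n expo \<times> 'd)"
  by (rule min_weight_eq[OF lead_in_mono])

lemma terms_above_in_mono:
  "f \<noteq> 0 \<Longrightarrow> terms_above (min_weight w f) (in_mono t w prec f :: 'n expo \<times> 'd) (coef f)"
  using lead_in_mono[of f] by (simp add: min_weight_in_mono lead_def)

lemma min_weight_finite:
  "f \<noteq> (0 :: ('a, 'n, 'd) pvec) \<Longrightarrow> min_weight w f \<noteq> \<infinity>"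
  by (simp add: min_weight_in_mono coef_in_mono)

lemma term_less_mterm_iff:
  fixes m m' :: "'n expo \<times> 'd"
  assumes "a \<noteq> (0 :: 'a)" "b \<noteq> 0"
  shows "term_less w prec (mterm a m) (mterm b m') \<longleftrightarrow>
    tweight a m < tweight b m' \<or> (tweight a m = tweight b m' \<and> mono_less prec m' m)"
  using assms by (auto simp: term_less_def mterm_inject tweight_def)

lemma terms_above_iff_lead:
  assumes "lead F m"
  shows "terms_above W p F \<longleftrightarrow> (if mono_less prec p m then W < tweight (F m) m else W \<le> tweight (F m) m)"
proof
  show "terms_above W p F \<Longrightarrow> if mono_less prec p m then W < tweight (F m) m else W \<le> tweight (F m) m"
    by (simp add: terms_above_def)
  show "if mono_less prec p m then W < tweight (F m) m else W \<le> tweight (F m) m \<Longrightarrow> terms_above W p F"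
    using assms by (auto simp: lead_def intro: terms_above_trans)
qed

text \<open>Through this equivalence all comparisons of initial terms become bounds of coefficient families.\<close>

lemma term_ge_iff:
  fixes f r :: "('a, 'n, 'd) pvec"
  assumes "f \<noteq> 0"
  shows "term_ge w prec (in_term t w prec r) (in_term t w prec f) \<longleftrightarrow>
    terms_above (min_weight w f) (in_mono t w prec f) (coef r)"
proof (cases "r = 0")
  case True
  have "0 = mterm a m \<longleftrightarrow> a = 0" for a :: 'a and m :: "'n expo \<times> 'd"
    by (metis mterm_eq_0_iff)
  then have "\<not> term_less w prec 0 (in_term t w prec f)"
    by (auto simp: term_less_def)
  moreover have "terms_above (min_weight w f) (in_mono t w prec f) (coef r)"
    using True min_weight_finite[OF assms] by (simp add: terms_above_def)
  ultimately show ?thesis using True by (simp add: in_term_def)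
next
  case False
  let ?m = "in_mono t w prec r :: 'n expo \<times> 'd" and ?p = "in_mono t w prec f :: 'n expo \<times> 'd"
  have "term_ge w prec (in_term t w prec r) (in_term t w prec f) \<longleftrightarrow>
      \<not> (tweight (coef r ?m) ?m < tweight (coef f ?p) ?p \<or>
         (tweight (coef r ?m) ?m = tweight (coef f ?p) ?p \<and> mono_less prec ?p ?m))"
    using False assms by (simp add: in_term_def term_less_mterm_iff coef_in_mono)
  then show ?thesis
    unfolding terms_above_iff_lead[OF lead_in_mono[OF False]] min_weight_in_mono[OF assms] by auto
qed

lemma term_dvd_in_term_iff:
  assumes "(g :: ('a, 'n, 'd) pvec) \<noteq> 0"
  shows "term_dvd (in_term t w prec g) (mterm 1 m) \<longleftrightarrow> (\<exists>u. m = shift u (in_mono t w prec g))"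
  using assms by (simp add: in_term_def term_dvd_iff coef_in_mono)

lemma homogeneous_of_in_mono:
  assumes "homogeneous (g :: ('a, 'n, 'd) pvec)" "g \<noteq> 0"
  shows "homogeneous_of (deg (fst (in_mono t w prec g :: 'n expo \<times> 'd))) g"
proof -
  obtain e where e: "homogeneous_of e g" using assms(1) by (auto simp: homogeneous_def)
  then have "deg (fst (in_mono t w prec g :: 'n expo \<times> 'd)) = e"
    using coef_in_mono[OF assms(2)] unfolding homogeneous_of_iff by blast
  then show ?thesis using e by simp
qed

section \<open>Existence of remainders\<close>

text \<open>The monomials of degree \<open>e\<close> divisible by some initial term of \<open>G\<close> are finite in number. Choosing
  one multiple of an element of \<open>G\<close> for each of them, \<open>division\<close> eliminates them all at once.\<close>

lemma remainder_exists:
  fixes G :: "('a, 'n, 'd) pvec set"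
  assumes "finite G" and G: "\<And>g. g \<in> G \<Longrightarrow> g \<noteq> 0 \<and> homogeneous g" and f: "homogeneous_of e f"
  shows "\<exists>r. is_remainder t w prec G f r"
proof (cases "f = 0")
  case True
  show ?thesis
    unfolding is_remainder_def
    by (rule exI[of _ 0]) (auto intro!: exI[of _ "\<lambda>_. 0"] homogeneous_of_0
        simp: True supp_def in_term_def term_less_def)
next
  case False
  define M where "M = {m :: 'n expo \<times> 'd. deg (fst m) = e \<and> (\<exists>g\<in>G. \<exists>u. m = shift u (in_mono t w prec g))}"
  have "finite M"
  proof (rule finite_subset)
    show "M \<subseteq> {u. deg u \<le> e} \<times> UNIV" by (rule subsetI) (simp add: M_def mem_Times_iff)
    show "finite ({u :: 'n expo. deg u \<le> e} \<times> (UNIV :: 'd set))" by (simp add: finite_deg_le)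
  qed
  have "\<forall>m\<in>M. \<exists>x. fst x \<in> G \<and> m = shift (snd x) (in_mono t w prec (fst x))"
  proof
    fix m assume "m \<in> M"
    then obtain g u where "g \<in> G" "m = shift u (in_mono t w prec g)" by (auto simp: M_def)
    then show "\<exists>x. fst x \<in> G \<and> m = shift (snd x) (in_mono t w prec (fst x))"
      by (intro exI[of _ "(g, u)"]) simp
  qed
  then have "\<exists>\<phi>. \<forall>m\<in>M. fst (\<phi> m) \<in> G \<and> m = shift (snd (\<phi> m)) (in_mono t w prec (fst (\<phi> m)))"
    by (rule bchoice)
  then obtain \<phi> where \<phi>: "\<And>m. m \<in> M \<Longrightarrow> fst (\<phi> m) \<in> G"
      "\<And>m. m \<in> M \<Longrightarrow> m = shift (snd (\<phi> m)) (in_mono t w prec (fst (\<phi> m)))" by blast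
  define E where "E m = tmult 1 (snd (\<phi> m)) (fst (\<phi> m))" for m
  have lead_E: "lead (coef (E m)) m" if "m \<in> M" for m
    unfolding E_def using lead_tmult[OF lead_in_mono, of "fst (\<phi> m)" 1 "snd (\<phi> m)"] \<phi>[OF that] G by simp
  have "\<exists>a. (\<forall>i\<in>M. coef f i = (\<Sum>m\<in>M. a m * coef (E m) i)) \<and>
      (\<forall>m\<in>M. terms_above (min_weight w f) (in_mono t w prec f) (\<lambda>i. a m * coef (E m) i))"
    using \<open>finite M\<close> lead_E terms_above_in_mono[OF False] min_weight_finite[OF False] by (rule division)
  then obtain a where a: "\<And>i. i \<in> M \<Longrightarrow> coef f i = (\<Sum>m\<in>M. a m * coef (E m) i)"
    and a_above: "\<And>m. m \<in> M \<Longrightarrow>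
      terms_above (min_weight w f) (in_mono t w prec f) (\<lambda>i. a m * coef (E m) i)" by blast
  have coef_aE: "coef (tmult (a m) (snd (\<phi> m)) (fst (\<phi> m))) i = a m * coef (E m) i" for m i
  proof -
    have "tmult (a m) (snd (\<phi> m)) (fst (\<phi> m)) = tmult (a m) 0 (E m)"
      by (simp only: E_def tmult_tmult) simp
    then show ?thesis by (simp only: coef_tmult_0)
  qed
  define h where "h g = (\<Sum>m\<in>{m\<in>M. fst (\<phi> m) = g}. Poly_Mapping.single (snd (\<phi> m)) (a m))" for g
  have h: "h g *s g = (\<Sum>m\<in>{m\<in>M. fst (\<phi> m) = g}. tmult (a m) (snd (\<phi> m)) (fst (\<phi> m)))" for g
    unfolding h_def by (subst pvec.scale_sum_left) (rule sum.cong, auto)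
  define r where "r = f - (\<Sum>m\<in>M. tmult (a m) (snd (\<phi> m)) (fst (\<phi> m)))"
  have coef_r: "coef r i = coef f i - (\<Sum>m\<in>M. a m * coef (E m) i)" for i
    by (simp add: r_def coef_diff coef_sum coef_aE)
  have sum_h: "(\<Sum>g\<in>G. h g *s g) = (\<Sum>m\<in>M. tmult (a m) (snd (\<phi> m)) (fst (\<phi> m)))"
    unfolding h using \<open>finite M\<close> assms(1) \<phi>(1) by (intro sum.group) auto
  have r_homog: "homogeneous_of e r"
    unfolding r_def
  proof (intro homogeneous_of_diff homogeneous_of_sum f)
    fix m assume m: "m \<in> M"
    let ?g = "fst (\<phi> m)"
    have "homogeneous_of (deg (snd (\<phi> m)) + deg (fst (in_mono t w prec ?g :: 'n expo \<times> 'd)))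
        (tmult (a m) (snd (\<phi> m)) ?g)"
      using G \<phi>(1)[OF m] by (intro homogeneous_of_tmult homogeneous_of_in_mono) auto
    moreover have "deg (fst m) = e" using m by (simp add: M_def)
    ultimately show "homogeneous_of e (tmult (a m) (snd (\<phi> m)) ?g)"
      using arg_cong[OF \<phi>(2)[OF m], of "\<lambda>m. deg (fst m)"] by (simp add: deg_add)
  qed
  have "is_remainder t w prec G f r"
    unfolding is_remainder_def
  proof (intro conjI exI[of _ e] exI[of _ h] ballI)
    show "f = (\<Sum>g\<in>G. h g *s g) + r" by (simp add: sum_h r_def)
    have "terms_above (min_weight w f) (in_mono t w prec f) (coef r)"
      unfolding coef_r[abs_def] using False
      by (intro terms_above_diff terms_above_sum a_above terms_above_in_mono min_weight_finite)
    then show "term_ge w prec (in_term t w prec r) (in_term t w prec f)"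
      by (simp add: term_ge_iff[OF False])
    show "term_ge w prec (in_term t w prec (h g *s g)) (in_term t w prec f)" for g
      unfolding term_ge_iff[OF False] h coef_sum[abs_def] coef_aE
      using min_weight_finite[OF False] by (intro terms_above_sum a_above) auto
    show "\<not> term_dvd (in_term t w prec g) (mterm 1 m)" if "m \<in> supp r" "g \<in> G" for m g
    proof
      assume "term_dvd (in_term t w prec g) (mterm 1 m)"
      then have "\<exists>u. m = shift u (in_mono t w prec g)"
        using G that by (simp add: term_dvd_in_term_iff)
      moreover have "deg (fst m) = e" using r_homog that by (simp add: homogeneous_of_def)
      ultimately have "m \<in> M" using that by (auto simp: M_def)
      then have "coef r m = 0" using a by (simp add: coef_r)
      then show False using that by (simp add: supp_def)
    qed
  qed (use False f r_homog in auto)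
  then show ?thesis ..
qed

section \<open>S-forms and standard representations\<close>

lemma S_form_eq:
  fixes f g :: "('a, 'n, 'd) pvec"
  defines "p \<equiv> in_mono t w prec f" and "q \<equiv> in_mono t w prec g"
  assumes "f \<noteq> 0" "g \<noteq> 0" "snd p = snd q"
  shows "S_form t w prec f g =
    tmult (inverse (coef f p)) (lcm_expo (fst p) (fst q) - fst p) f -
    tmult (inverse (coef g q)) (lcm_expo (fst p) (fst q) - fst q) g"
proof -
  let ?l = "lcm_expo (fst p) (fst q)"
  have p: "(?l, snd p) = shift (?l - fst p) p" and q: "(?l, snd p) = shift (?l - fst q) q"
    using lcm_expo_left[of "fst p" "fst q"] lcm_expo_right[of "fst p" "fst q"] assms(5)
    by (simp_all add: shift_def)
  have "lcm_mono p q = (mterm 1 (?l, snd p) :: ('a, 'n, 'd) pvec)" using assms(5) by (simp add: lcm_mono_def)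
  moreover have "term_quot (mterm 1 (?l, snd p)) (in_term t w prec f)
      = Poly_Mapping.single (?l - fst p) (inverse (coef f p))"
    unfolding p in_term_def p_def[symmetric] using assms(3) coef_in_mono[OF assms(3)]
    by (simp add: term_quot_eq p_def)
  moreover have "term_quot (mterm 1 (?l, snd p)) (in_term t w prec g)
      = Poly_Mapping.single (?l - fst q) (inverse (coef g q))"
    unfolding q in_term_def q_def[symmetric] using assms(4) coef_in_mono[OF assms(4)]
    by (simp add: term_quot_eq q_def)
  ultimately show ?thesis by (simp add: S_form_def p_def[symmetric] q_def[symmetric])
qed

lemma S_form_eq_0:
  "snd (in_mono t w prec f) \<noteq> snd (in_mono t w prec g) \<Longrightarrow> S_form t w prec f (g :: ('a, 'n, 'd) pvec) = 0"
  by (simp add: S_form_def lcm_mono_def)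

lemma lcm_expo_commute: "lcm_expo u v = lcm_expo v u"
  by (rule poly_mapping_eqI) (simp add: lookup_lcm_expo max.commute)

lemma S_form_commute:
  fixes f g :: "('a, 'n, 'd) pvec"
  assumes "f \<noteq> 0" "g \<noteq> 0"
  shows "S_form t w prec g f = - S_form t w prec f g"
proof (cases "snd (in_mono t w prec f :: 'n expo \<times> 'd) = snd (in_mono t w prec g :: 'n expo \<times> 'd)")
  case True
  then show ?thesis using assms by (simp add: S_form_eq lcm_expo_commute)
next
  case False
  then show ?thesis by (simp add: S_form_eq_0)
qed

lemma S_form_self: "f \<noteq> 0 \<Longrightarrow> S_form t w prec f f = (0 :: ('a, 'n, 'd) pvec)"
  by (simp add: S_form_eq)

text \<open>Both halves of the S-form are scaled to have the leading term \<open>1\<close> at the least common multiple,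
  where they cancel.\<close>

lemma S_form_above:
  fixes f g :: "('a, 'n, 'd) pvec"
  defines "p \<equiv> in_mono t w prec f" and "q \<equiv> in_mono t w prec g"
  assumes "f \<noteq> 0" "g \<noteq> 0" "snd p = snd q"
  defines "m \<equiv> (lcm_expo (fst p) (fst q), snd p)"
  shows "terms_above (ereal (weight w (fst m))) m (coef (S_form t w prec f g))"
    and "coef (S_form t w prec f g) m = 0"
proof -
  let ?l = "lcm_expo (fst p) (fst q)"
  have mp: "m = shift (?l - fst p) p" and mq: "m = shift (?l - fst q) q"
    using lcm_expo_left[of "fst p" "fst q"] lcm_expo_right[of "fst p" "fst q"] assms(5)
    by (simp_all add: shift_def m_def)
  have one: "terms_above (ereal (weight w (fst m))) m (coef (tmult (inverse (coef h n)) u h))"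
    and one': "coef (tmult (inverse (coef h n)) u h) m = 1"
    if "m = shift u n" "h \<noteq> 0" "n = in_mono t w prec h" for u n h
  proof -
    have l: "lead (coef (tmult (inverse (coef h n)) u h)) m"
      unfolding that(1) using that(2,3) coef_in_mono[of h] by (intro lead_tmult) (auto intro: lead_in_mono)
    show c: "coef (tmult (inverse (coef h n)) u h) m = 1"
      unfolding that(1) using that(2,3) coef_in_mono[of h] by simp
    show "terms_above (ereal (weight w (fst m))) m (coef (tmult (inverse (coef h n)) u h))"
      using l unfolding lead_def c by (simp add: tweight_def)
  qed
  have S: "S_form t w prec f g = tmult (inverse (coef f p)) (?l - fst p) f -
      tmult (inverse (coef g q)) (?l - fst q) g"
    unfolding p_def q_def by (rule S_form_eq) (use assms in auto)
  show "terms_above (ereal (weight w (fst m))) m (coef (S_form t w prec f g))"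
    unfolding S coef_diff[abs_def] 
    by (intro terms_above_diff one[OF mp assms(3)] one[OF mq assms(4)]) (simp_all add: p_def q_def)
  show "coef (S_form t w prec f g) m = 0"
    unfolding S coef_diff using one'[OF mp assms(3)] one'[OF mq assms(4)] by (simp add: p_def q_def)
qed

lemma homogeneous_S_form:
  fixes f g :: "('a, 'n, 'd) pvec"
  assumes "f \<noteq> 0" "g \<noteq> 0" "homogeneous f" "homogeneous g"
  shows "\<exists>e. homogeneous_of e (S_form t w prec f g)"
proof (cases "snd (in_mono t w prec f :: 'n expo \<times> 'd) = snd (in_mono t w prec g :: 'n expo \<times> 'd)")
  case True
  let ?p = "fst (in_mono t w prec f :: 'n expo \<times> 'd)" and ?q = "fst (in_mono t w prec g :: 'n expo \<times> 'd)"
  let ?l = "lcm_expo ?p ?q"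
  have "homogeneous_of (deg (?l - ?p) + deg ?p) (tmult a (?l - ?p) f)"
    and "homogeneous_of (deg (?l - ?q) + deg ?q) (tmult b (?l - ?q) g)" for a b
    using assms by (auto intro: homogeneous_of_tmult homogeneous_of_in_mono)
  then have "homogeneous_of (deg ?l) (tmult a (?l - ?p) f)"
    and "homogeneous_of (deg ?l) (tmult b (?l - ?q) g)" for a b
    unfolding deg_add[symmetric] lcm_expo_left[symmetric] lcm_expo_right[symmetric] .
  then show ?thesis
    using True assms by (auto simp: S_form_eq intro: homogeneous_of_diff)
next
  case False
  then show ?thesis by (simp add: S_form_eq_0 homogeneous_of_0)
qed

text \<open>This is a division with remainder \<open>0\<close>; adding a nonzero remainder to \<open>G\<close> turns any division into one.
  Unlike the remainder property it persists when \<open>G\<close> grows.\<close>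

definition standard_rep :: "('a, 'n, 'd) pvec set \<Rightarrow> ('a, 'n, 'd) pvec \<Rightarrow> bool" where
  "standard_rep G f \<longleftrightarrow> (\<exists>h. f = (\<Sum>g\<in>G. h g *s g) \<and>
     (\<forall>g\<in>G. term_ge w prec (in_term t w prec (h g *s g)) (in_term t w prec f)))"

lemma term_ge_0: "term_ge w prec 0 p"
proof -
  have "0 = mterm a m \<longleftrightarrow> a = 0" for a :: 'a and m :: "'n expo \<times> 'd"
    by (metis mterm_eq_0_iff)
  then show ?thesis by (auto simp: term_less_def)
qed

lemma standard_rep_0: "standard_rep G 0"
  unfolding standard_rep_def by (rule exI[of _ "\<lambda>_. 0"]) (simp add: in_term_def term_ge_0)

lemma in_mono_uminus: "in_mono t w prec (- f :: ('a, 'n, 'd) pvec) = (in_mono t w prec f :: 'n expo \<times> 'd)"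
proof (cases "f = 0")
  case False
  then have "lead (coef (tmult (- 1) 0 f)) (shift 0 (in_mono t w prec f))"
    by (intro lead_tmult lead_in_mono) auto
  moreover have "coef (tmult (- 1) 0 f) = coef (- f)"
    by (rule ext) (simp only: coef_tmult_0 coef_uminus mult_minus_left mult_1_left)
  ultimately show ?thesis by (intro in_mono_eq) (simp add: shift_def)
qed simp

lemma standard_rep_uminus:
  assumes "standard_rep G f"
  shows "standard_rep G (- f)"
proof (cases "f = 0")
  case False
  obtain h where h: "f = (\<Sum>g\<in>G. h g *s g)"
    and above: "\<And>g. g \<in> G \<Longrightarrow> terms_above (min_weight w f) (in_mono t w prec f) (coef (h g *s g))"
    using assms False unfolding standard_rep_def by (auto simp: term_ge_iff)
  have minw: "min_weight w (- f) = min_weight w f"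
    using False by (simp add: min_weight_in_mono in_mono_uminus coef_uminus)
  have "- f = (\<Sum>g\<in>G. - h g *s g)"
    by (simp only: pvec.scale_minus_left sum_negf h[symmetric])
  moreover have "terms_above (min_weight w (- f)) (in_mono t w prec (- f)) (coef (- h g *s g))" if "g \<in> G" for g
    unfolding pvec.scale_minus_left coef_uminus[abs_def] minw in_mono_uminus
    using above[OF that] by (rule terms_above_uminus)
  then have "term_ge w prec (in_term t w prec (- h g *s g)) (in_term t w prec (- f))" if "g \<in> G" for g
    using that False by (subst term_ge_iff) auto
  ultimately show ?thesis unfolding standard_rep_def by (intro exI[of _ "\<lambda>g. - h g"]) blast
qed (simp add: standard_rep_0)

lemma standard_rep_mono:
  assumes "standard_rep G f" "G \<subseteq> H" "finite H"
  shows "standard_rep H f"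
proof -
  obtain h where h: "f = (\<Sum>g\<in>G. h g *s g)"
    and ge: "\<And>g. g \<in> G \<Longrightarrow> term_ge w prec (in_term t w prec (h g *s g)) (in_term t w prec f)"
    using assms(1) by (auto simp: standard_rep_def)
  define h' where "h' g = (if g \<in> G then h g else 0)" for g
  have "f = (\<Sum>g\<in>H. h' g *s g)"
    unfolding h using assms(2,3) by (intro sum.mono_neutral_cong_left) (auto simp: h'_def)
  moreover have "term_ge w prec (in_term t w prec (h' g *s g)) (in_term t w prec f)" for g
    using ge by (cases "g \<in> G") (simp_all add: h'_def in_term_def[of _ _ _ 0] term_ge_0)
  ultimately show ?thesis unfolding standard_rep_def by blast
qed

lemma in_mono_remainder_not_divisible:
  assumes "is_remainder t w prec G f r" "r \<noteq> (0 :: ('a, 'n, 'd) pvec)" "g \<in> G" "g \<noteq> 0"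
  shows "in_mono t w prec r \<noteq> shift u (in_mono t w prec g :: 'n expo \<times> 'd)"
proof
  assume "in_mono t w prec r = shift u (in_mono t w prec g :: 'n expo \<times> 'd)"
  then have "term_dvd (in_term t w prec g) (mterm 1 (in_mono t w prec r))"
    using assms(4) by (auto simp: term_dvd_in_term_iff)
  moreover have "in_mono t w prec r \<in> supp r"
    using coef_in_mono[OF assms(2)] by (simp add: supp_def)
  ultimately show False using assms(1,3) unfolding is_remainder_def by blast
qed

text \<open>A nonzero remainder is itself bounded by the initial term of \<open>f\<close>, so it may join \<open>G\<close> with the quotient \<open>1\<close>.\<close>

lemma standard_rep_remainder:
  assumes "is_remainder t w prec G f r" "finite G" "\<And>g. g \<in> G \<Longrightarrow> g \<noteq> (0 :: ('a, 'n, 'd) pvec)"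
  shows "standard_rep (if r = 0 then G else G \<union> {r}) f"
proof -
  obtain h where h: "f = (\<Sum>g\<in>G. h g *s g) + r"
    and r_ge: "term_ge w prec (in_term t w prec r) (in_term t w prec f)"
    and ge: "\<And>g. g \<in> G \<Longrightarrow> term_ge w prec (in_term t w prec (h g *s g)) (in_term t w prec f)"
    using assms(1) unfolding is_remainder_def by blast
  show ?thesis
  proof (cases "r = 0")
    case True
    then show ?thesis using h ge unfolding standard_rep_def by auto
  next
    case False
    have "r \<notin> G"
      using in_mono_remainder_not_divisible[OF assms(1) False, of r 0] False by (auto simp: shift_def)
    define h' where "h' = h(r := 1)"
    have h': "h' g *s g = h g *s g" if "g \<in> G" for g
      using \<open>r \<notin> G\<close> that by (auto simp: h'_def)
    have "f = (\<Sum>g\<in>G \<union> {r}. h' g *s g)"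
      using assms(2) \<open>r \<notin> G\<close> h by (simp add: h' add.commute) (simp add: h'_def)
    moreover have "term_ge w prec (in_term t w prec (h' g *s g)) (in_term t w prec f)" if "g \<in> G \<union> {r}" for g
      using that ge[of g] r_ge h'[of g] by (auto simp: h'_def)
    ultimately show ?thesis using False unfolding standard_rep_def by auto
  qed
qed

section \<open>Buchberger's criterion\<close>

text \<open>The multiples of \<open>g\<close> by the terms of \<open>h\<close> have distinct leading monomials, so the smallest of their
  leading terms survives in the sum and a bound of the sum bounds all of them.\<close>

lemma tmult_terms_above:
  fixes g :: "('a, 'n, 'd) pvec"
  assumes "g \<noteq> 0" "terms_above W p (coef (h *s g))" "u \<in> Poly_Mapping.keys h"
  shows "terms_above W p (coef (tmult (Poly_Mapping.lookup h u) u g))"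
proof (rule terms_above_summands[where J = "Poly_Mapping.keys h" and mu = "\<lambda>u. shift u (in_mono t w prec g)"])
  show "inj_on (\<lambda>u. shift u (in_mono t w prec g :: 'n expo \<times> 'd)) (Poly_Mapping.keys h)"
    by (rule inj_onI) (simp add: shift_def)
  show "lead (coef (tmult (Poly_Mapping.lookup h u) u g)) (shift u (in_mono t w prec g))"
    if "u \<in> Poly_Mapping.keys h" for u
    using that assms(1) by (intro lead_tmult lead_in_mono) (auto simp: in_keys_iff)
  show "terms_above W p (\<lambda>i. \<Sum>u\<in>Poly_Mapping.keys h. coef (tmult (Poly_Mapping.lookup h u) u g) i)"
    using assms(2) by (subst (asm) smult_eq_sum_tmult) (simp only: coef_sum[abs_def])
qed (use assms(3) in auto)

lemma coef_tmult_eq_0_of_deg: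
  assumes "homogeneous_of e f" "deg (fst i) \<noteq> deg u + e"
  shows "coef (tmult a u f) i = 0"
  using homogeneous_of_tmult[OF assms(1), of u a] assms(2) unfolding homogeneous_of_iff by blast

text \<open>Since \<open>F\<close> may be inhomogeneous, all multiples \<open>x\<^sup>u g\<close> of degree at most \<open>N\<close> are used together, where \<open>N\<close> is
  large enough for the representation of \<open>F\<close>. The quotients of an S-form may involve
  terms of other degrees. Discarding all coefficients of degree above \<open>N\<close> removes the multiples outside
  the finite index set \<open>J\<close> and leaves the others unchanged, because the elements of \<open>G\<close> are homogeneous.\<close>

lemma buchberger_criterion:
  fixes G :: "('a, 'n, 'd) pvec set"
  assumes "finite G" and G: "\<And>g. g \<in> G \<Longrightarrow> g \<noteq> 0 \<and> homogeneous g"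
    and S: "\<And>f g. f \<in> G \<Longrightarrow> g \<in> G \<Longrightarrow> standard_rep G (S_form t w prec f g)"
    and F: "F \<in> submodule_span G" "F \<noteq> 0"
  shows "\<exists>(M :: ('n expo \<times> 'd) set) a u g. finite M \<and> F = (\<Sum>m\<in>M. tmult (a m) (u m) (g m)) \<and>
    (\<forall>m\<in>M. g m \<in> G \<and> terms_above (min_weight w F) (in_mono t w prec F) (coef (tmult (a m) (u m) (g m))))"
proof -
  let ?lm = "\<lambda>g. in_mono t w prec g :: 'n expo \<times> 'd"
  have homog: "homogeneous_of (deg (fst (?lm g))) g" if "g \<in> G" for g
    using G[OF that] by (intro homogeneous_of_in_mono) auto
  obtain h where h: "F = (\<Sum>g\<in>G. h g *s g)"
    using F(1) assms(1) by (auto simp: pvec.span_finite)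
  obtain N where N: "\<And>g u. g \<in> G \<Longrightarrow> u \<in> Poly_Mapping.keys (h g) \<Longrightarrow> deg (u + fst (?lm g)) \<le> N"
  proof -
    have "finite (\<Union>g\<in>G. (\<lambda>u. deg (u + fst (?lm g))) ` Poly_Mapping.keys (h g))"
      using assms(1) by auto
    then show ?thesis using that by (auto simp: finite_nat_set_iff_bounded_le)
  qed
  define J where "J = {(u, g). g \<in> G \<and> deg (u + fst (?lm g)) \<le> N}"
  have "finite J"
  proof (rule finite_subset)
    show "J \<subseteq> {u. deg u \<le> N} \<times> G" by (auto simp: J_def deg_add)
    show "finite ({u :: 'n expo. deg u \<le> N} \<times> G)" using assms(1) by (simp add: finite_deg_le)
  qed
  define E where "E j = coef (tmult 1 (fst j) (snd j))" for j :: "'n expo \<times> ('a, 'n, 'd) pvec"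
  define mu where "mu j = shift (fst j) (?lm (snd j))" for j
  have lead_E: "lead (E j) (mu j)" if "j \<in> J" for j
    unfolding E_def mu_def using that G by (intro lead_tmult lead_in_mono) (auto simp: J_def)
  have coef_E: "coef (tmult a (fst j) (snd j)) i = a * E j i" for a j i
  proof -
    have "tmult a (fst j) (snd j) = tmult a 0 (tmult 1 (fst j) (snd j))" by (simp only: tmult_tmult) simp
    then show ?thesis by (simp only: coef_tmult_0 E_def)
  qed
  \<comment> \<open>Truncation at degree \<open>N\<close> keeps or kills a multiple of \<open>g\<close> as a whole.\<close>
  have cut_E: "(if deg (fst i) \<le> N then coef (tmult a u g) i else 0)
      = (if (u, g) \<in> J then a * E (u, g) i else 0)" if "g \<in> G" for a u g i
  proof (cases "deg (fst i) = deg u + deg (fst (?lm g))")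
    case True
    then show ?thesis using that coef_E[of "(u, g)" a i] by (simp add: J_def deg_add)
  next
    case False
    then show ?thesis
      using coef_tmult_eq_0_of_deg[OF homog[OF that] False] by (simp add: E_def)
  qed
  define c where "c m = (SOME j. j \<in> J \<and> mu j = m)" for m
  have c: "c (mu j) \<in> J \<and> mu (c (mu j)) = mu j" if "j \<in> J" for j
    unfolding c_def by (rule someI[of "\<lambda>k. k \<in> J \<and> mu k = mu j" j]) (use that in simp)
  have red: "\<exists>\<alpha>. strict_comb J E mu (tweight (E j (mu j)) (mu j)) (mu j) (\<lambda>i. E j i - \<alpha> * E (c (mu j)) i)"
    if j: "j \<in> J" for j
  proof -
    \<comment> \<open>\<open>E j\<close> and the vector chosen for its leading monomial are multiples of two elements of \<open>G\<close>; with
      matching coefficients their difference is a multiple of the S-form.\<close>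
    obtain u g where jug: "j = (u, g)" by (cases j)
    obtain v f where jvf: "c (mu j) = (v, f)" by (cases "c (mu j)")
    have g: "g \<in> G" and f: "f \<in> G" using j c[OF j] unfolding jvf by (auto simp: jug J_def)
    then have nz: "g \<noteq> 0" "f \<noteq> 0" using G by auto
    let ?p = "?lm g" and ?q = "?lm f" and ?S = "S_form t w prec g f"
    let ?l = "lcm_expo (fst ?p) (fst ?q)"
    let ?m = "(?l, snd ?p)"
    have mu_eq: "shift u ?p = shift v ?q" using c[OF j] unfolding jvf by (simp add: mu_def jug)
    then have snd_eq: "snd ?p = snd ?q" and "u + fst ?p = v + fst ?q" by (auto simp: shift_def)
    then obtain s where s: "u = s + (?l - fst ?p)" "v = s + (?l - fst ?q)"
      using lcm_expo_least by blast
    have mu_j: "mu j = shift s ?m"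
      using s(1) lcm_expo_left[of "fst ?p" "fst ?q"]
      by (simp add: mu_def jug shift_def add.assoc flip: lcm_expo_left)
    let ?a = "coef g ?p" and ?b = "coef f ?q"
    have a: "?a \<noteq> 0" using coef_in_mono nz by blast
    have S_eq: "tmult ?a s ?S = tmult 1 u g - tmult (?a * inverse ?b) v f"
      unfolding S_form_eq[OF nz snd_eq] pvec.scale_right_diff_distrib tmult_tmult s[symmetric]
      using a by simp
    have diff: "E j i - (?a * inverse ?b) * E (c (mu j)) i = coef (tmult ?a s ?S) i" for i
      unfolding S_eq coef_diff using coef_E[of j 1 i] coef_E[of "c (mu j)" "?a * inverse ?b" i]
      unfolding jvf by (simp add: jug)
    have W: "tweight (E j (mu j)) (mu j) = val ?a + ereal (weight w s) + ereal (weight w ?l)"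
    proof -
      have "E j (mu j) = ?a" by (simp add: E_def mu_def jug)
      then show ?thesis by (simp add: mu_j tweight_def weight_add add.assoc)
    qed
    obtain \<kappa> where \<kappa>: "val ?a = ereal \<kappa>"
      using a val_eq_PInfty_iff[of ?a] val_neq_MInfty[of ?a] by (cases "val ?a") auto
    have "strict_comb J E mu (tweight (E j (mu j)) (mu j)) (mu j) (coef (tmult ?a s ?S))"
    proof (cases "?S = 0")
      case True
      then show ?thesis using strict_comb_0[of "tweight (E j (mu j)) (mu j)" J E mu "mu j"] W \<kappa>
        by (simp add: coef_0[abs_def])
    next
      case False
      obtain k where k: "?S = (\<Sum>x\<in>G. k x *s x)"
        and k_above: "\<And>x. x \<in> G \<Longrightarrow> terms_above (min_weight w ?S) (?lm ?S) (coef (k x *s x))"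
        using S[OF g f] False unfolding standard_rep_def by (auto simp: term_ge_iff)
      have "tmult ?a s ?S
          = (\<Sum>x\<in>G. \<Sum>y\<in>Poly_Mapping.keys (k x). tmult (?a * Poly_Mapping.lookup (k x) y) (s + y) x)"
        unfolding k pvec.scale_sum_right
        by (subst smult_eq_sum_tmult) (simp only: pvec.scale_sum_right tmult_tmult)
      then have coef_eq: "coef (tmult ?a s ?S) i = (\<Sum>x\<in>G. \<Sum>y\<in>Poly_Mapping.keys (k x).
          if (s + y, x) \<in> J then (?a * Poly_Mapping.lookup (k x) y) * E (s + y, x) i else 0)" for i
      proof -
        assume *: "tmult ?a s ?S
          = (\<Sum>x\<in>G. \<Sum>y\<in>Poly_Mapping.keys (k x). tmult (?a * Poly_Mapping.lookup (k x) y) (s + y) x)"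
        have "coef (tmult ?a s ?S) i = (if deg (fst i) \<le> N then coef (tmult ?a s ?S) i else 0)"
          unfolding diff[symmetric] using cut_E[OF g, of i u 1] cut_E[OF f, of i v 1] j c[OF j]
          unfolding jvf by (auto simp: jug E_def)
        also have "\<dots> = (\<Sum>x\<in>G. \<Sum>y\<in>Poly_Mapping.keys (k x).
            if deg (fst i) \<le> N then coef (tmult (?a * Poly_Mapping.lookup (k x) y) (s + y) x) i else 0)"
          unfolding * coef_sum by auto
        also have "\<dots> = (\<Sum>x\<in>G. \<Sum>y\<in>Poly_Mapping.keys (k x).
            if (s + y, x) \<in> J then (?a * Poly_Mapping.lookup (k x) y) * E (s + y, x) i else 0)"
          by (intro sum.cong refl cut_E)
        finally show ?thesis .
      qed
      have "strict_comb J E mu (tweight (E j (mu j)) (mu j)) (mu j)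
          (\<lambda>i. if (s + y, x) \<in> J then (?a * Poly_Mapping.lookup (k x) y) * E (s + y, x) i else 0)"
        if x: "x \<in> G" and y: "y \<in> Poly_Mapping.keys (k x)" for x y
      proof (cases "(s + y, x) \<in> J")
        case True
        let ?c = "Poly_Mapping.lookup (k x) y * coef x (?lm x)"
        let ?z = "shift y (?lm x)"
        have "terms_above (min_weight w ?S) (?lm ?S) (coef (tmult (Poly_Mapping.lookup (k x) y) y x))"
          using G[OF x] y k_above[OF x] by (intro tmult_terms_above) auto
        then have "if mono_less prec ?z ?m
            then ereal (weight w (fst ?m)) \<le> tweight (coef (tmult (Poly_Mapping.lookup (k x) y) y x) ?z) ?z
            else ereal (weight w (fst ?m)) < tweight (coef (tmult (Poly_Mapping.lookup (k x) y) y x) ?z) ?z"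
          unfolding min_weight_in_mono[OF False]
          using S_form_above[OF nz snd_eq] lead_in_mono[OF False] by (intro strictly_above)
        then have *: "if mono_less prec ?z ?m then ereal (weight w ?l) \<le> tweight ?c ?z
            else ereal (weight w ?l) < tweight ?c ?z" by (simp split: if_splits)
        have E_mu: "E (s + y, x) (mu (s + y, x)) = coef x (?lm x)"
          by (simp add: E_def mu_def)
        have mu_sy: "mu (s + y, x) = shift s ?z" by (simp add: mu_def shift_shift)
        have tweight_eq: "tweight (?a * Poly_Mapping.lookup (k x) y * E (s + y, x) (mu (s + y, x))) (mu (s + y, x))
            = ereal \<kappa> + (tweight ?c ?z + ereal (weight w s))"
          unfolding E_mu unfolding mu_sy mult.assoc
          by (simp only: tweight_mult[of ?a] \<kappa> tweight_shift add.assoc)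
        have less_iff: "mono_less prec (mu (s + y, x)) (mu j) \<longleftrightarrow> mono_less prec ?z ?m"
          by (simp only: mu_sy mu_j mono_less_shift)
        have "if mono_less prec (mu (s + y, x)) (mu j)
            then tweight (E j (mu j)) (mu j) \<le>
              tweight (?a * Poly_Mapping.lookup (k x) y * E (s + y, x) (mu (s + y, x))) (mu (s + y, x))
            else tweight (E j (mu j)) (mu j) <
              tweight (?a * Poly_Mapping.lookup (k x) y * E (s + y, x) (mu (s + y, x))) (mu (s + y, x))"
          unfolding tweight_eq less_iff W \<kappa> using * by (cases "tweight ?c ?z") (auto split: if_splits)
        then show ?thesis
          using True strict_comb_single[OF \<open>finite J\<close> True, of "tweight (E j (mu j)) (mu j)" mu "mu j"] W \<kappa>
          by simp
      next
        case False
        then show ?thesis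
          using strict_comb_0[of "tweight (E j (mu j)) (mu j)" J E mu "mu j"] W \<kappa> by simp
      qed
      then show ?thesis
        unfolding coef_eq[abs_def] using W \<kappa> by (intro strict_comb_sum) auto
    qed
    then show ?thesis unfolding diff[symmetric, abs_def] by blast
  qed
  let ?M = "mu ` J"
  have "finite ?M" using \<open>finite J\<close> by simp
  have E_comb: "lin_comb ?M (\<lambda>m. E (c m)) (E j)" if "j \<in> J" for j
    unfolding lin_comb_def
    by (rule strict_reduction_imp_span[OF \<open>finite J\<close> lead_E _ c red that])
      (simp_all add: E_def finite_coef_neq_0)
  have "coef F = (\<lambda>i. \<Sum>g\<in>G. \<Sum>u\<in>Poly_Mapping.keys (h g). Poly_Mapping.lookup (h g) u * E (u, g) i)"
    unfolding h coef_sum[abs_def]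
    by (subst smult_eq_sum_tmult) (simp add: coef_sum coef_E[of "(_, _)", simplified])
  moreover have "lin_comb ?M (\<lambda>m. E (c m))
      (\<lambda>i. \<Sum>g\<in>G. \<Sum>u\<in>Poly_Mapping.keys (h g). Poly_Mapping.lookup (h g) u * E (u, g) i)"
    by (intro lin_comb_sum lin_comb_scale E_comb) (auto simp: J_def N)
  ultimately obtain a where a: "\<And>i. coef F i = (\<Sum>m\<in>?M. a m * E (c m) i)"
    unfolding lin_comb_def by auto
  define M where "M = {m\<in>?M. a m \<noteq> 0}"
  have "finite M" using \<open>finite ?M\<close> by (simp add: M_def)
  have a': "coef F i = (\<Sum>m\<in>M. a m * E (c m) i)" for i
    unfolding a using \<open>finite ?M\<close> by (intro sum.mono_neutral_right) (auto simp: M_def)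
  have cM: "c m \<in> J" "mu (c m) = m" if "m \<in> M" for m using that c by (auto simp: M_def)
  have "terms_above (min_weight w F) (?lm F) (\<lambda>i. a m * E (c m) i)" if "m \<in> M" for m
  proof (rule terms_above_summands[where J = M and mu = "\<lambda>m. m" and E = "\<lambda>m i. a m * E (c m) i"])
    show "lead (\<lambda>i. a m * E (c m) i) m" if "m \<in> M" for m
      using lead_E[of "c m"] cM[OF that] that by (intro lead_scale) (auto simp: M_def)
    show "terms_above (min_weight w F) (?lm F) (\<lambda>i. \<Sum>m\<in>M. a m * E (c m) i)"
      using terms_above_in_mono[OF F(2)] by (simp add: a'[abs_def])
  qed (use that \<open>finite M\<close> in auto)
  then have "\<forall>m\<in>M. snd (c m) \<in> G \<and>
      terms_above (min_weight w F) (?lm F) (coef (tmult (a m) (fst (c m)) (snd (c m))))"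
    using cM by (auto simp: coef_E[abs_def] J_def split_beta)
  moreover have "F = (\<Sum>m\<in>M. tmult (a m) (fst (c m)) (snd (c m)))"
    by (rule pvec_eqI) (simp add: a' coef_sum coef_E)
  ultimately show ?thesis using \<open>finite M\<close>
    by (intro exI[of _ M] exI[of _ a] exI[of _ "\<lambda>m. fst (c m)"] exI[of _ "\<lambda>m. snd (c m)"]) blast
qed

end

section \<open>Initial forms of combinations\<close>

lemma abs_residue_add:
  fixes a b :: "'a::valued_field"
  assumes "0 \<le> val a" "0 \<le> val b"
  shows "abs_residue (a + b) = abs_residue a + abs_residue b"
  using assms by (subst plus_residue.abs_eq) auto

lemma abs_residue_mult:
  fixes a b :: "'a::valued_field"
  assumes "0 \<le> val a" "0 \<le> val b"
  shows "abs_residue (a * b) = abs_residue a * abs_residue b"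
  using assms by (subst times_residue.abs_eq) auto

lemma abs_residue_sum:
  fixes f :: "'i \<Rightarrow> 'a::valued_field"
  assumes "\<And>i. i \<in> A \<Longrightarrow> 0 \<le> val (f i)"
  shows "abs_residue (sum f A) = (\<Sum>i\<in>A. abs_residue (f i))"
  using assms
proof (induction A rule: infinite_finite_induct)
  case (insert x A)
  then show ?case by (simp add: abs_residue_add val_sum_ge)
qed (simp_all flip: zero_residue.abs_eq)

context valued_order
begin

text \<open>The coefficient, at the monomial \<open>m\<close>, of the part of weight \<open>W\<close>. Unlike the initial form itself this is
  additive in \<open>c\<close> as long as the weights are at least \<open>W\<close>, since the normalizing power of \<open>t\<close> does not depend on \<open>c\<close>.\<close>

definition residue_coef :: "real \<Rightarrow> 'a \<Rightarrow> 'n expo \<times> 'd \<Rightarrow> 'a residue" where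
  "residue_coef W c m = abs_residue (c * t (weight w (fst m) - W))"

lemma group_diff:
  "\<gamma> \<in> value_group TYPE('a) \<Longrightarrow> \<delta> \<in> value_group TYPE('a) \<Longrightarrow> \<gamma> - \<delta> \<in> value_group TYPE('a)"
  using value_group_add[of \<gamma> "- \<delta>"] value_group_uminus[of \<delta>] by simp

lemma val_residue_arg:
  assumes "W \<in> value_group TYPE('a)"
  shows "val (c * t (weight w (fst m) - W)) = tweight c m - ereal W"
proof -
  have "val (t (weight w (fst m) - W)) = ereal (weight w (fst m) - W)"
    by (rule val_t(2)[OF group_diff[OF weight_in_group assms]])
  then show ?thesis by (cases "val c") (auto simp: val_times tweight_def)
qed

lemma residue_arg_nonneg:
  "W \<in> value_group TYPE('a) \<Longrightarrow> ereal W \<le> tweight c m \<Longrightarrow> 0 \<le> val (c * t (weight w (fst m) - W))"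
  by (cases "tweight c m") (auto simp: val_residue_arg)

lemma residue_coef_eq_0:
  assumes "W \<in> value_group TYPE('a)" "ereal W < tweight c m"
  shows "residue_coef W c m = 0"
proof -
  have "0 < val (c * t (weight w (fst m) - W))"
    using assms by (cases "tweight c m") (auto simp: val_residue_arg)
  then show ?thesis by (simp add: residue_coef_def abs_residue_eq_0_iff)
qed

lemma min_weight_in_group:
  assumes "f \<noteq> (0 :: ('a, 'n, 'd) pvec)"
  obtains W where "min_weight w f = ereal W" "W \<in> value_group TYPE('a)"
proof
  let ?m = "in_mono t w prec f :: 'n expo \<times> 'd"
  let ?W = "real_of_ereal (val (coef f ?m)) + weight w (fst ?m)"
  have c: "coef f ?m \<noteq> 0" by (rule coef_in_mono[OF assms])
  show "min_weight w f = ereal ?W"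
    unfolding min_weight_in_mono[OF assms] tweight_def plus_ereal.simps(1)[symmetric] val_in_group(2)[OF c] ..
  show "?W \<in> value_group TYPE('a)"
    by (intro value_group_add val_in_group c weight_in_group)
qed

lemma min_weight_le: "f \<noteq> (0 :: ('a, 'n, 'd) pvec) \<Longrightarrow> min_weight w f \<le> tweight (coef f m) m"
  using terms_above_in_mono[of f] unfolding terms_above_def by (metis order.strict_implies_order)

lemma coef_in_form_residue:
  fixes f :: "('a, 'n, 'd) pvec"
  assumes "f \<noteq> 0" "min_weight w f = ereal W" "W \<in> value_group TYPE('a)"
  shows "coef (in_form t w f) m = residue_coef W (coef f m) m"
proof (cases "tweight (coef f m) m = min_weight w f")
  case True
  then have "coef f m \<noteq> 0" using assms(2) by auto
  then have "weight w (fst m) - W = - real_of_ereal (val (coef f m))"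
    using True assms(2) val_in_group(2)[of "coef f m"] by (cases "val (coef f m)") (auto simp: tweight_def)
  then show ?thesis
    using True \<open>coef f m \<noteq> 0\<close> by (simp add: coef_in_form supp_def residue_coef_def)
next
  case False
  then have "ereal W < tweight (coef f m) m" using min_weight_le[OF assms(1), of m] assms(2) by simp
  then show ?thesis using False assms(3) by (simp add: coef_in_form residue_coef_eq_0)
qed

text \<open>The part of weight \<open>W\<close> of a multiple of \<open>g\<close> is a multiple of the initial form of \<open>g\<close> if \<open>W\<close> is
  the smallest weight that occurs, and \<open>0\<close> if all weights are larger.\<close>

lemma residue_coef_tmult:
  fixes g :: "('a, 'n, 'd) pvec"
  assumes "g \<noteq> 0" "W \<in> value_group TYPE('a)" "\<And>i. ereal W \<le> tweight (coef (tmult a u g) i) i"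
  shows "\<exists>q. \<forall>i. coef (q *s in_form t w g) i = residue_coef W (coef (tmult a u g) i) i"
proof (cases "a = 0")
  case True
  have "residue_coef W 0 i = 0" for i
    using assms(2) by (intro residue_coef_eq_0) auto
  then show ?thesis using True by (intro exI[of _ 0]) simp
next
  case False
  obtain Wg where Wg: "min_weight w g = ereal Wg" "Wg \<in> value_group TYPE('a)"
    using min_weight_in_group[OF assms(1)] .
  obtain \<alpha> where \<alpha>: "val a = ereal \<alpha>" "\<alpha> \<in> value_group TYPE('a)"
    using val_in_group[OF False] by metis
  let ?p = "in_mono t w prec g :: 'n expo \<times> 'd"
  have tweight_eq: "tweight (coef (tmult a u g) (shift u i)) (shift u i) = tweight (coef g i) i + ereal (\<alpha> + weight w u)" for i
    by (cases "tweight (coef g i) i") (auto simp: tweight_mult tweight_shift \<alpha>)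
  have le: "W \<le> Wg + (\<alpha> + weight w u)"
    using assms(3)[of "shift u ?p"] unfolding tweight_eq min_weight_in_mono[OF assms(1), symmetric] Wg by simp
  show ?thesis
  proof (cases "W = Wg + (\<alpha> + weight w u)")
    case True
    let ?c = "a * t (- \<alpha>)"
    have c: "val ?c = 0"
      using val_t(2)[OF value_group_uminus[OF \<alpha>(2)]] by (simp add: val_times \<alpha>)
    have "coef (tmult (abs_residue ?c) u (in_form t w g)) i = residue_coef W (coef (tmult a u g) i) i" for i
    proof (cases "\<exists>i'. i = shift u i'")
      case True
      then obtain i' where i: "i = shift u i'" ..
      have "weight w (fst i) - W = - \<alpha> + (weight w (fst i') - Wg)"
        using \<open>W = _\<close> by (simp add: i weight_add)
      then have t_eq: "t (weight w (fst i) - W) = t (- \<alpha>) * t (weight w (fst i') - Wg)"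
        using t_add[OF value_group_uminus[OF \<alpha>(2)] group_diff[OF weight_in_group Wg(2)]] by simp
      have "coef (tmult (abs_residue ?c) u (in_form t w g)) i
          = abs_residue ?c * residue_coef Wg (coef g i') i'"
        by (simp add: i coef_in_form_residue[OF assms(1) Wg])
      also have "\<dots> = abs_residue (?c * (coef g i' * t (weight w (fst i') - Wg)))"
        unfolding residue_coef_def
        using c min_weight_le[OF assms(1), of i'] Wg
        by (intro abs_residue_mult[symmetric] residue_arg_nonneg) auto
      also have "?c * (coef g i' * t (weight w (fst i') - Wg))
          = coef (tmult a u g) i * t (weight w (fst i) - W)"
        unfolding t_eq by (simp add: i ac_simps)
      finally show ?thesis by (simp add: residue_coef_def)
    next
      case False
      then have "coef (tmult a u g) i = 0" "coef (tmult (abs_residue ?c) u (in_form t w g)) i = 0"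
        by (auto intro!: coef_tmult_eq_0)
      then show ?thesis using assms(2) by (simp add: residue_coef_eq_0)
    qed
    then show ?thesis by blast
  next
    case False
    have "ereal W < tweight (coef (tmult a u g) i) i" for i
    proof (cases rule: coef_tmult_cases[of i u a g])
      case (1 i')
      have "ereal Wg \<le> tweight (coef g i') i'" using min_weight_le[OF assms(1)] Wg by metis
      then show ?thesis
        using False le unfolding 1(1) tweight_eq by (cases "tweight (coef g i') i'") auto
    qed simp
    then show ?thesis using assms(2) by (intro exI[of _ 0]) (simp add: residue_coef_eq_0)
  qed
qed

text \<open>No summand of the representation given by \<open>buchberger_criterion\<close> has a term of weight less than that of
  \<open>F\<close>, so the parts of this weight add up to the initial form of \<open>F\<close>.\<close>

lemma in_form_in_span:
  fixes G :: "('a, 'n, 'd) pvec set"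
  assumes "finite G" "\<And>g. g \<in> G \<Longrightarrow> g \<noteq> 0 \<and> homogeneous g"
    and "\<And>f g. f \<in> G \<Longrightarrow> g \<in> G \<Longrightarrow> standard_rep G (S_form t w prec f g)"
    and "F \<in> submodule_span G" "F \<noteq> 0"
  shows "in_form t w F \<in> submodule_span (in_form t w ` G)"
proof -
  obtain M :: "('n expo \<times> 'd) set" and a u g where M: "finite M"
    and F: "F = (\<Sum>m\<in>M. tmult (a m) (u m) (g m))"
    and g: "\<And>m. m \<in> M \<Longrightarrow> g m \<in> G"
    and above: "\<And>m. m \<in> M \<Longrightarrow> terms_above (min_weight w F) (in_mono t w prec F) (coef (tmult (a m) (u m) (g m)))"
    using buchberger_criterion[OF assms] by blast
  obtain W where W: "min_weight w F = ereal W" "W \<in> value_group TYPE('a)"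
    using min_weight_in_group[OF assms(5)] .
  have ge: "ereal W \<le> tweight (coef (tmult (a m) (u m) (g m)) i) i" if "m \<in> M" for m i
    using above[OF that] unfolding W terms_above_def by (metis order.strict_implies_order)
  have "\<forall>m\<in>M. \<exists>q. \<forall>i. coef (q *s in_form t w (g m)) i = residue_coef W (coef (tmult (a m) (u m) (g m)) i) i"
    using g assms(2) ge W(2) by (intro ballI residue_coef_tmult) auto
  then have "\<exists>q. \<forall>m\<in>M. \<forall>i. coef (q m *s in_form t w (g m)) i = residue_coef W (coef (tmult (a m) (u m) (g m)) i) i"
    by (rule bchoice)
  then obtain q where q: "\<And>m i. m \<in> M \<Longrightarrow>
      coef (q m *s in_form t w (g m)) i = residue_coef W (coef (tmult (a m) (u m) (g m)) i) i" by blast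
  have "in_form t w F = (\<Sum>m\<in>M. q m *s in_form t w (g m))"
  proof (rule pvec_eqI)
    fix i
    have "coef (in_form t w F) i = residue_coef W (coef F i) i"
      by (rule coef_in_form_residue[OF assms(5) W])
    also have "\<dots> = abs_residue (\<Sum>m\<in>M. coef (tmult (a m) (u m) (g m)) i * t (weight w (fst i) - W))"
      unfolding residue_coef_def by (simp only: F coef_sum sum_distrib_right)
    also have "\<dots> = (\<Sum>m\<in>M. residue_coef W (coef (tmult (a m) (u m) (g m)) i) i)"
      unfolding residue_coef_def using W(2) ge by (intro abs_residue_sum residue_arg_nonneg)
    also have "\<dots> = coef (\<Sum>m\<in>M. q m *s in_form t w (g m)) i"
      by (simp add: coef_sum q)
    finally show "coef (in_form t w F) i = coef (\<Sum>m\<in>M. q m *s in_form t w (g m)) i" .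
  qed
  also have "\<dots> \<in> submodule_span (in_form t w ` G)"
    using g by (intro pvec.span_sum pvec.span_scale pvec.span_base) auto
  finally show ?thesis .
qed

lemma in_form_0: "in_form t w (0 :: ('a, 'n, 'd) pvec) = 0"
  by (rule pvec_eqI) (simp add: coef_in_form supp_def)

lemma groebner_basisI:
  fixes G :: "('a, 'n, 'd) pvec set"
  assumes "finite G" "\<And>g. g \<in> G \<Longrightarrow> g \<noteq> 0 \<and> homogeneous g"
    and "\<And>f g. f \<in> G \<Longrightarrow> g \<in> G \<Longrightarrow> standard_rep G (S_form t w prec f g)"
  shows "groebner_basis t w (submodule_span G) G"
proof -
  have "in_form t w ` submodule_span G \<subseteq> submodule_span (in_form t w ` G)"
  proof (rule image_subsetI)
    fix F assume "F \<in> submodule_span G"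
    then show "in_form t w F \<in> submodule_span (in_form t w ` G)"
      using in_form_in_span[OF assms] by (cases "F = 0") (auto simp: in_form_0 pvec.span_zero)
  qed
  then have "in_module t w (submodule_span G) \<subseteq> submodule_span (in_form t w ` G)"
    unfolding in_module_def by (intro pvec.span_minimal pvec.subspace_span)
  moreover have "submodule_span (in_form t w ` G) \<subseteq> in_module t w (submodule_span G)"
    unfolding in_module_def by (intro pvec.span_mono image_mono pvec.span_superset)
  ultimately show ?thesis using assms(1) by (simp add: groebner_basis_def)
qed

end

section \<open>Dickson's lemma\<close>

lemma mono_subseq_nat:
  fixes s :: "nat \<Rightarrow> nat"
  shows "\<exists>\<phi> :: nat \<Rightarrow> nat. strict_mono \<phi> \<and> mono (\<lambda>n. s (\<phi> n))"
proof -
  obtain \<psi> :: "nat \<Rightarrow> nat" where \<psi>: "strict_mono \<psi>" "monoseq (\<lambda>n. s (\<psi> n))" using seq_monosub by blast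
  show ?thesis
  proof (cases "incseq (\<lambda>n. s (\<psi> n))")
    case True
    then show ?thesis using \<psi>(1) by blast
  next
    case False
    then have dec: "decseq (\<lambda>n. s (\<psi> n))" using \<psi>(2) by (simp add: monoseq_iff)
    define k where "k = (LEAST x. x \<in> range (\<lambda>n. s (\<psi> n)))"
    have "k \<in> range (\<lambda>n. s (\<psi> n))" unfolding k_def by (rule LeastI) auto
    then obtain N where N: "s (\<psi> N) = k" by auto
    have "s (\<psi> (n + N)) = k" for n
    proof (rule antisym)
      show "s (\<psi> (n + N)) \<le> k" using decseqD[OF dec, of N "n + N"] N by simp
      show "k \<le> s (\<psi> (n + N))" unfolding k_def by (rule Least_le) auto
    qed
    then show ?thesis
      using \<psi>(1) by (intro exI[of _ "\<lambda>n. \<psi> (n + N)"]) (auto simp: strict_mono_def mono_def)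
  qed
qed

lemma mono_subseq_family:
  fixes s :: "nat \<Rightarrow> 'x \<Rightarrow> nat"
  assumes "finite X"
  shows "\<exists>\<phi> :: nat \<Rightarrow> nat. strict_mono \<phi> \<and> (\<forall>x\<in>X. mono (\<lambda>n. s (\<phi> n) x))"
  using assms
proof (induction X)
  case empty
  show ?case by (rule exI[of _ "\<lambda>n. n"]) (simp add: strict_mono_def)
next
  case (insert x X)
  then obtain \<phi> :: "nat \<Rightarrow> nat" where \<phi>: "strict_mono \<phi>" "\<And>y. y \<in> X \<Longrightarrow> mono (\<lambda>n. s (\<phi> n) y)" by blast
  obtain \<psi> :: "nat \<Rightarrow> nat" where \<psi>: "strict_mono \<psi>" "mono (\<lambda>n. s (\<phi> (\<psi> n)) x)"
    using mono_subseq_nat[of "\<lambda>n. s (\<phi> n) x"] by blast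
  have "strict_mono (\<lambda>n. \<phi> (\<psi> n))" using \<phi>(1) \<psi>(1) by (simp add: strict_mono_def)
  moreover have "mono (\<lambda>n. s (\<phi> (\<psi> n)) y)" if "y \<in> X" for y
    using \<phi>(2)[OF that] strict_mono_mono[OF \<psi>(1)] by (auto simp: mono_def)
  ultimately show ?case using \<psi>(2) by (intro exI[of _ "\<lambda>n. \<phi> (\<psi> n)"]) auto
qed

text \<open>The basis vector of a monomial is encoded by indicator coordinates: as these are increasing along
  the subsequence, the basis vector does not change.\<close>

lemma dickson:
  fixes m :: "nat \<Rightarrow> 'n::finite expo \<times> 'd::finite"
  shows "\<exists>i j u. i < j \<and> m j = shift u (m i)"
proof -
  define s :: "nat \<Rightarrow> 'n + 'd \<Rightarrow> nat" where
    "s n x = (case x of Inl i \<Rightarrow> Poly_Mapping.lookup (fst (m n)) i | Inr k \<Rightarrow> if snd (m n) = k then 1 else 0)" for n x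
  obtain \<phi> :: "nat \<Rightarrow> nat" where \<phi>: "strict_mono \<phi>" "\<And>x. mono (\<lambda>n. s (\<phi> n) x)"
    using mono_subseq_family[of UNIV s] by auto
  let ?i = "\<phi> 0" and ?j = "\<phi> 1"
  have le: "s ?i x \<le> s ?j x" for x using monoD[OF \<phi>(2), of 0 1 x] by simp
  have "snd (m ?j) = snd (m ?i)"
    using le[of "Inr (snd (m ?i))"] by (simp add: s_def split: if_splits)
  moreover have "fst (m ?j) = (fst (m ?j) - fst (m ?i)) + fst (m ?i)"
    by (rule expo_add_diff) (use le[of "Inl _"] in \<open>simp add: s_def\<close>)
  ultimately have "m ?j = shift (fst (m ?j) - fst (m ?i)) (m ?i)" by (simp add: shift_def prod_eq_iff)
  moreover have "?i < ?j" using \<phi>(1) by (simp add: strict_mono_def)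
  ultimately show ?thesis by blast
qed

section \<open>The procedure\<close>

context valued_order
begin

text \<open>When a nonzero remainder \<open>r\<close> is added, the loop enqueues the pairs with \<open>r\<close> in one order only and not the pair
  \<open>(r, r)\<close>. This suffices because S-forms are antisymmetric.\<close>

definition loop_invariant ::
    "('a, 'n, 'd) pvec set \<Rightarrow> ('a, 'n, 'd) pvec set \<Rightarrow> (('a, 'n, 'd) pvec \<times> ('a, 'n, 'd) pvec) set \<Rightarrow> bool" where
  "loop_invariant B G C \<longleftrightarrow> finite G \<and> C \<subseteq> G \<times> G \<and> (\<forall>g\<in>G. g \<noteq> 0 \<and> homogeneous g) \<and>
     submodule_span G = submodule_span B \<and>
     (\<forall>f\<in>G. \<forall>g\<in>G. (f, g) \<in> C \<or> (g, f) \<in> C \<or> standard_rep G (S_form t w prec f g))"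

lemma submodule_span_insert_remainder:
  fixes G :: "('a, 'n, 'd) pvec set"
  assumes "is_remainder t w prec G (S_form t w prec f g) r" "f \<in> G" "g \<in> G"
  shows "submodule_span (G \<union> {r}) = submodule_span G"
proof -
  obtain h where h: "S_form t w prec f g = (\<Sum>g\<in>G. h g *s g) + r"
    using assms(1) unfolding is_remainder_def by blast
  have "S_form t w prec f g \<in> submodule_span G"
    unfolding S_form_def Let_def using assms(2,3)
    by (auto intro: pvec.span_diff pvec.span_scale pvec.span_base pvec.span_zero)
  moreover have "(\<Sum>g\<in>G. h g *s g) \<in> submodule_span G"
    by (intro pvec.span_sum pvec.span_scale pvec.span_base)
  ultimately have "S_form t w prec f g - (\<Sum>g\<in>G. h g *s g) \<in> submodule_span G"
    by (rule pvec.span_diff)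
  then have "r \<in> submodule_span G" by (simp add: h)
  then have "submodule_span (G \<union> {r}) \<subseteq> submodule_span G"
    by (intro pvec.span_minimal pvec.subspace_span) (auto intro: pvec.span_base)
  moreover have "submodule_span G \<subseteq> submodule_span (G \<union> {r})" by (rule pvec.span_mono) auto
  ultimately show ?thesis by (rule antisym)
qed

lemma loop_invariant_step:
  assumes "loop_invariant B G C" "buchberger_step t w prec (G, C) (G', C')"
  shows "loop_invariant B G' C'"
  using assms(2)
proof cases
  case (zero f g)
  have fg: "f \<in> G" "g \<in> G" and nz: "\<And>x. x \<in> G \<Longrightarrow> x \<noteq> 0" and "finite G"
    using assms(1) zero(3) by (auto simp: loop_invariant_def)
  have rep: "standard_rep G (S_form t w prec f g)"
    using standard_rep_remainder[OF zero(4) \<open>finite G\<close>] nz by simp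
  then have "standard_rep G (S_form t w prec g f)"
    using S_form_commute[OF nz[OF fg(1)] nz[OF fg(2)]] standard_rep_uminus by metis
  then show ?thesis
    using assms(1) rep unfolding zero(1,2) loop_invariant_def by blast
next
  case (nonzero f g r)
  have fg: "f \<in> G" "g \<in> G" and nz: "\<And>x. x \<in> G \<Longrightarrow> x \<noteq> 0" and "finite G"
    using assms(1) nonzero(3) by (auto simp: loop_invariant_def)
  let ?G = "G \<union> {r}"
  have rep: "standard_rep ?G (S_form t w prec f g)"
    using standard_rep_remainder[OF nonzero(4) \<open>finite G\<close>] nz nonzero(5) by simp
  then have rep': "standard_rep ?G (S_form t w prec g f)"
    using S_form_commute[OF nz[OF fg(1)] nz[OF fg(2)]] standard_rep_uminus by metis
  have "homogeneous r"
    using nonzero(4) unfolding is_remainder_def homogeneous_def by blast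
  have "x = y \<and> x = r \<or> (x, y) \<in> C - {(f, g)} \<union> G \<times> {r} \<or> (y, x) \<in> C - {(f, g)} \<union> G \<times> {r} \<or>
      standard_rep ?G (S_form t w prec x y)" if "x \<in> ?G" "y \<in> ?G" for x y
  proof (cases "x = r \<or> y = r")
    case False
    then have "x \<in> G" "y \<in> G" using that by auto
    then have "(x, y) \<in> C \<or> (y, x) \<in> C \<or> standard_rep G (S_form t w prec x y)"
      using assms(1) by (simp add: loop_invariant_def)
    then show ?thesis using rep rep' standard_rep_mono[of G _ ?G] \<open>finite G\<close> by auto
  qed (use that in auto)
  moreover have "standard_rep ?G (S_form t w prec r r)"
    using S_form_self[OF nonzero(5)] standard_rep_0 by simp
  ultimately have "(x, y) \<in> C - {(f, g)} \<union> G \<times> {r} \<or> (y, x) \<in> C - {(f, g)} \<union> G \<times> {r} \<or>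
      standard_rep ?G (S_form t w prec x y)" if "x \<in> ?G" "y \<in> ?G" for x y
    using that by metis
  moreover have "submodule_span ?G = submodule_span B"
    using assms(1) submodule_span_insert_remainder[OF nonzero(4) fg] by (simp add: loop_invariant_def)
  ultimately show ?thesis
    using assms(1) nonzero(5) \<open>homogeneous r\<close> unfolding nonzero(1,2) loop_invariant_def by blast
qed

lemma loop_invariant_reachable:
  assumes "finite B" "\<And>b. b \<in> B \<Longrightarrow> b \<noteq> 0 \<and> homogeneous b"
    and "(buchberger_step t w prec)\<^sup>*\<^sup>* (B, B \<times> B) S"
  shows "loop_invariant B (fst S) (snd S)"
  using assms(3)
proof induction
  case base
  then show ?case using assms(1,2) by (simp add: loop_invariant_def)
next
  case (step S S')
  then show ?case using loop_invariant_step[of B "fst S" "snd S" "fst S'" "snd S'"] by simp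
qed

lemma buchberger_terminates:
  assumes "finite B" "\<And>b. b \<in> B \<Longrightarrow> b \<noteq> 0 \<and> homogeneous (b :: ('a, 'n, 'd) pvec)"
  shows "\<nexists>S. S 0 = (B, B \<times> B) \<and> (\<forall>j. buchberger_step t w prec (S j) (S (Suc j)))"
proof
  assume "\<exists>S. S 0 = (B, B \<times> B) \<and> (\<forall>j. buchberger_step t w prec (S j) (S (Suc j)))"
  then obtain S where S0: "S 0 = (B, B \<times> B)" and step: "\<And>j. buchberger_step t w prec (S j) (S (Suc j))"
    by blast
  let ?G = "\<lambda>j. fst (S j)" and ?C = "\<lambda>j. snd (S j)"
  have "(buchberger_step t w prec)\<^sup>*\<^sup>* (B, B \<times> B) (S j)" for j
    by (induction j) (auto simp: S0 intro: rtranclp.rtrancl_into_rtrancl step)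
  then have inv: "loop_invariant B (?G j) (?C j)" for j
    using loop_invariant_reachable[OF assms] by blast
  have step': "buchberger_step t w prec (?G j, ?C j) (?G (Suc j), ?C (Suc j))" for j
    using step by simp
  have mono: "?G i \<subseteq> ?G j" if "i \<le> j" for i j
  proof (rule lift_Suc_mono_le[OF _ that])
    show "?G n \<subseteq> ?G (Suc n)" for n using step'[of n] by cases auto
  qed
  have finC: "finite (?C j)" for j
    using inv[of j] unfolding loop_invariant_def by (meson finite_SigmaI finite_subset)
  define Z where "Z = {j. ?G (Suc j) \<noteq> ?G j}"
  have new: "\<exists>r. r \<in> ?G (Suc j) \<and> (\<forall>g\<in>?G j. \<forall>u. in_mono t w prec r \<noteq> shift u (in_mono t w prec g :: 'n expo \<times> 'd))"
    if "j \<in> Z" for j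
    using step'[of j]
  proof cases
    case zero
    then show ?thesis using that by (simp add: Z_def)
  next
    case (nonzero f g r)
    have "\<forall>g\<in>?G j. g \<noteq> 0" using inv[of j] by (simp add: loop_invariant_def)
    then show ?thesis
      using in_mono_remainder_not_divisible[OF nonzero(4,5)] nonzero(1) by (intro exI[of _ r]) auto
  qed
  \<comment> \<open>Otherwise the set of pairs would eventually shrink in every step.\<close>
  have "infinite Z"
  proof
    assume "finite Z"
    then obtain N where N: "\<And>j. j \<in> Z \<Longrightarrow> j < N" by (auto simp: finite_nat_set_iff_bounded)
    have "card (?C (Suc j)) < card (?C j)" if "N \<le> j" for j
    proof -
      have jZ: "j \<notin> Z" using N[of j] that by auto
      show ?thesis
        using step'[of j]
      proof cases
        case (zero f g)
        then show ?thesis using finC[of j] by (metis card_Diff1_less)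
      next
        case (nonzero f g r)
        then have "r \<in> ?G j" using jZ by (auto simp: Z_def)
        then have "r \<noteq> 0" and "in_mono t w prec r = shift 0 (in_mono t w prec r :: 'n expo \<times> 'd)"
          using inv[of j] by (auto simp: loop_invariant_def shift_def)
        then show ?thesis
          using in_mono_remainder_not_divisible[OF nonzero(4) _ \<open>r \<in> ?G j\<close>] by blast
      qed
    qed
    then have "card (?C (N + k)) + k \<le> card (?C N)" for k
    proof (induction k)
      case (Suc k)
      then show ?case using Suc.prems[of "N + k"] Suc.IH by fastforce
    qed simp
    from this[of "Suc (card (?C N))"] show False by simp
  qed
  obtain r where r: "\<And>j. j \<in> Z \<Longrightarrow> r j \<in> ?G (Suc j)"
    and r_new: "\<And>j g u. j \<in> Z \<Longrightarrow> g \<in> ?G j \<Longrightarrow> in_mono t w prec (r j) \<noteq> shift u (in_mono t w prec g :: 'n expo \<times> 'd)"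
  proof -
    have "\<exists>r. \<forall>j\<in>Z. r j \<in> ?G (Suc j) \<and>
        (\<forall>g\<in>?G j. \<forall>u. in_mono t w prec (r j) \<noteq> shift u (in_mono t w prec g :: 'n expo \<times> 'd))"
      by (rule bchoice) (use new in blast)
    then show ?thesis using that by blast
  qed
  obtain i j u where "i < j"
    and *: "in_mono t w prec (r (enumerate Z j)) = shift u (in_mono t w prec (r (enumerate Z i)) :: 'n expo \<times> 'd)"
    using dickson[of "\<lambda>n. in_mono t w prec (r (enumerate Z n)) :: 'n expo \<times> 'd"] by blast
  have Zi: "enumerate Z i \<in> Z" and Zj: "enumerate Z j \<in> Z"
    using \<open>infinite Z\<close> by (simp_all add: enumerate_in_set)
  have "Suc (enumerate Z i) \<le> enumerate Z j"
    using enumerate_mono[OF \<open>i < j\<close> \<open>infinite Z\<close>] by simp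
  then have "r (enumerate Z i) \<in> ?G (enumerate Z j)" using r[OF Zi] mono by blast
  then show False using r_new[OF Zj] * by blast
qed

end

theorem mainTheorem3:
  fixes t :: "real \<Rightarrow> 'a::valued_field"
    and w :: "real ^ 'n::finite"
    and prec :: "'n expo \<Rightarrow> 'n expo \<Rightarrow> bool"
    and B I :: "('a, 'n, 'd::{finite,linorder}) pvec set"
  assumes "val_section t"
    and "\<And>i. w $ i \<in> value_group TYPE('a)"
    and "monomial_order prec"
    and "finite B"
    and "\<And>b. b \<in> B \<Longrightarrow> b \<noteq> 0 \<and> homogeneous b"
    and "I = submodule_span B"
  shows
    \<comment> \<open>the loop never runs forever, whatever choices are made\<close>
    "(\<nexists>S. S 0 = (B, B \<times> B) \<and> (\<forall>j. buchberger_step t w prec (S j) (S (Suc j)))) \<and>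
    \<comment> \<open>the loop never gets stuck: every pair that may be chosen has a remainder\<close>
     (\<forall>G C f g. (buchberger_step t w prec)\<^sup>*\<^sup>* (B, B \<times> B) (G, C) \<longrightarrow> (f, g) \<in> C \<longrightarrow>
        (\<exists>r. is_remainder t w prec G (S_form t w prec f g) r)) \<and>
    \<comment> \<open>every set that can be returned is a Groebner basis\<close>
     (\<forall>G. (buchberger_step t w prec)\<^sup>*\<^sup>* (B, B \<times> B) (G, {}) \<longrightarrow> groebner_basis t w I G)"
proof -
  interpret valued_order t w prec "TYPE('d)"
    using assms(1-3) by unfold_locales
  have inv: "loop_invariant B G C" if "(buchberger_step t w prec)\<^sup>*\<^sup>* (B, B \<times> B) (G, C)" for G C
    using loop_invariant_reachable[OF assms(4,5) that] by simp
  show ?thesis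
  proof (intro conjI allI impI)
    show "\<nexists>S. S 0 = (B, B \<times> B) \<and> (\<forall>j. buchberger_step t w prec (S j) (S (Suc j)))"
      by (rule buchberger_terminates[OF assms(4,5)])
  next
    fix G C f g
    assume "(buchberger_step t w prec)\<^sup>*\<^sup>* (B, B \<times> B) (G, C)" "(f, g) \<in> C"
    then have *: "finite G" "f \<in> G" "g \<in> G" "\<And>x. x \<in> G \<Longrightarrow> x \<noteq> 0 \<and> homogeneous x"
      using inv unfolding loop_invariant_def by blast+
    then obtain e where "homogeneous_of e (S_form t w prec f g)"
      using homogeneous_S_form by blast
    then show "\<exists>r. is_remainder t w prec G (S_form t w prec f g) r"
      using remainder_exists[OF *(1,4)] by blast
  next
    fix G
    assume "(buchberger_step t w prec)\<^sup>*\<^sup>* (B, B \<times> B) (G, {})"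
    then have "loop_invariant B G {}" by (rule inv)
    then show "groebner_basis t w I G"
      using groebner_basisI[of G] assms(6) by (simp add: loop_invariant_def)
  qed
qed

end
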